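(* Let $m,s\in\mathbb{N}$ and let $\mathbb{F}=\prod_{i=1}^s\mathbb{F}_{p_i}$ and $\mathbb{K}=\prod_{j=1}^m\mathbb{F}_{q_j}$ be products of finite fields such that $|\mathbb{K}|$ and $|\mathbb{F}|$ are coprime. Then the cardinality of the lattice $\mathcal{L}(\mathbb{F},\mathbb{K})$ of all $(\mathbb{F},\mathbb{K})$-linearly closed clonoids is bounded by $$|\mathcal{L}(\mathbb{F},\mathbb{K})|\le\prod_{i=1}^s\ \sum_{1\le r\le n}\binom{n}{r}_{p_i},$$ where $n=\prod_{j=1}^m q_j$ and, for $q\in\mathbb{N}\setminus\{1\}$, $$\binom{n}{h}_q=\prod_{i=1}^h\frac{q^{n-h+i}-1}{q^i-1}.$$
   Context: $\mathbb{N}$ is the set of positive integers, and for a prime power $q$, $\mathbb{F}_q$ is the field with $q$ elements; here all $q_j$ and $p_i$ are prime powers (with repetitions allowed). For $k\in\mathbb{N}$, a $k$-ary function from $\mathbb{K}=\prod_{j=1}^m\mathbb{F}_{q_j}$ to $\mathbb{F}=\prod_{i=1}^s\mathbb{F}_{p_i}$ is a function $f\colon\prod_{j=1}^m\mathbb{F}_{q_j}^k\to\mathbb{F}$. For a set $C$ of such functions of various arities, $C^{[k]}$ denotes the set of its $k$-ary members. An $(\mathbb{F},\mathbb{K})$-linearly closed clonoid is a non-empty set $C$ of finitary functions from $\mathbb{K}$ to $\mathbb{F}$ (of arities $k\in\mathbb{N}$) such that: (1) for all $n\in\mathbb{N}$, $\mathbf{a},\mathbf{b}\in\mathbb{F}$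 and $f,g\in C^{[n]}$, we have $\mathbf{a}f+\mathbf{b}g\in C^{[n]}$, where $\mathbf{a}f$ denotes the component-wise product in $\prod_{i=1}^s\mathbb{F}_{p_i}$; (2) for all $l,n\in\mathbb{N}$, $f\in C^{[n]}$ and matrices $A_j\in\mathbb{F}_{q_j}^{n\times l}$ ($1\le j\le m$), the function $(\mathbf{x}_1,\dots,\mathbf{x}_m)\mapsto f(A_1\mathbf{x}_1,\dots,A_m\mathbf{x}_m)$ from $\prod_{j=1}^m\mathbb{F}_{q_j}^l$ to $\mathbb{F}$ (vectors regarded as columns) is in $C^{[l]}$. $\mathcal{L}(\mathbb{F},\mathbb{K})$ denotes the set of all $(\mathbb{F},\mathbb{K})$-linearly closed clonoids, ordered by inclusion (meet is intersection, join is the clonoid generated by the union). *)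

theory Defs
  imports Complex_Main "HOL-Algebra.Ring" "HOL-Algebra.Coset" "HOL-Algebra.Complete_Lattice"
begin

text \<open>
  Elements of the direct product are extensional functions on the index set, as in
  the carrier of \<open>product_group\<close>.
\<close>

definition product_ring :: "'i set \<Rightarrow> ('i \<Rightarrow> ('a, 'x) ring_scheme) \<Rightarrow> ('i \<Rightarrow> 'a) ring" where
  "product_ring I R =
     \<lparr>carrier = (\<Pi>\<^sub>E i\<in>I. carrier (R i)),
      mult = (\<lambda>a b. \<lambda>i\<in>I. a i \<otimes>\<^bsub>R i\<^esub> b i),
      one = (\<lambda>i\<in>I. \<one>\<^bsub>R i\<^esub>),
      zero = (\<lambda>i\<in>I. \<zero>\<^bsub>R i\<^esub>),
      add = (\<lambda>a b. \<lambda>i\<in>I. a i \<oplus>\<^bsub>R i\<^esub> b i)\<rparr>"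

text \<open>
  A point of \<open>\<Prod>\<^sub>j K\<^sub>j\<^sup>k\<close> is a function \<open>x\<close> with \<open>x j t\<close> the \<open>t\<close>-th coordinate of the
  \<open>j\<close>-th vector, where \<open>j \<in> {1..m}\<close> and \<open>t \<in> {1..k}\<close>.
\<close>

definition arg_space :: "nat \<Rightarrow> (nat \<Rightarrow> ('a, 'x) ring_scheme) \<Rightarrow> nat \<Rightarrow> (nat \<Rightarrow> nat \<Rightarrow> 'a) set" where
  "arg_space m K k = (\<Pi>\<^sub>E j\<in>{1..m}. \<Pi>\<^sub>E t\<in>{1..k}. carrier (K j))"

definition kary_functions ::
    "('f, 'y) ring_scheme \<Rightarrow> nat \<Rightarrow> (nat \<Rightarrow> ('a, 'x) ring_scheme) \<Rightarrow> nat
      \<Rightarrow> ((nat \<Rightarrow> nat \<Rightarrow> 'a) \<Rightarrow> 'f) set" where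
  "kary_functions F m K k = arg_space m K k \<rightarrow>\<^sub>E carrier F"

text \<open>
  A finitary function is stored as a pair of its arity and its graph: for total functions
  in HOL the arity cannot be read off from the function itself.
\<close>

definition arity_part :: "(nat \<times> 'g) set \<Rightarrow> nat \<Rightarrow> 'g set" where
  "arity_part C k = {f. (k, f) \<in> C}"

definition matrices :: "('a, 'x) ring_scheme \<Rightarrow> nat \<Rightarrow> nat \<Rightarrow> (nat \<Rightarrow> nat \<Rightarrow> 'a) set" where
  "matrices R n l = (\<Pi>\<^sub>E r\<in>{1..n}. \<Pi>\<^sub>E t\<in>{1..l}. carrier R)"

definition mat_vec ::
    "('a, 'x) ring_scheme \<Rightarrow> nat \<Rightarrow> nat \<Rightarrow> (nat \<Rightarrow> nat \<Rightarrow> 'a) \<Rightarrow> (nat \<Rightarrow> 'a) \<Rightarrow> nat \<Rightarrow> 'a" where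
  "mat_vec R n l A x = (\<lambda>r\<in>{1..n}. \<Oplus>\<^bsub>R\<^esub>t\<in>{1..l}. A r t \<otimes>\<^bsub>R\<^esub> x t)"

definition linearly_closed_clonoid ::
    "('f, 'y) ring_scheme \<Rightarrow> nat \<Rightarrow> (nat \<Rightarrow> ('a, 'x) ring_scheme)
      \<Rightarrow> (nat \<times> ((nat \<Rightarrow> nat \<Rightarrow> 'a) \<Rightarrow> 'f)) set \<Rightarrow> bool" where
  "linearly_closed_clonoid F m K C \<longleftrightarrow>
     C \<noteq> {} \<and>
     (\<forall>(k, f)\<in>C. 1 \<le> k \<and> f \<in> kary_functions F m K k) \<and>
     (\<forall>n\<ge>1. \<forall>a\<in>carrier F. \<forall>b\<in>carrier F. \<forall>f\<in>arity_part C n. \<forall>g\<in>arity_part C n.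
        (\<lambda>x\<in>arg_space m K n. (a \<otimes>\<^bsub>F\<^esub> f x) \<oplus>\<^bsub>F\<^esub> (b \<otimes>\<^bsub>F\<^esub> g x)) \<in> arity_part C n) \<and>
     (\<forall>l\<ge>1. \<forall>n\<ge>1. \<forall>f\<in>arity_part C n. \<forall>A\<in>(\<Pi>\<^sub>E j\<in>{1..m}. matrices (K j) n l).
        (\<lambda>x\<in>arg_space m K l. f (\<lambda>j\<in>{1..m}. mat_vec (K j) n l (A j) (x j))) \<in> arity_part C l)"

definition clonoid_lattice ::
    "('f, 'y) ring_scheme \<Rightarrow> nat \<Rightarrow> (nat \<Rightarrow> ('a, 'x) ring_scheme)
      \<Rightarrow> (nat \<times> ((nat \<Rightarrow> nat \<Rightarrow> 'a) \<Rightarrow> 'f)) set gorder" where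
  "clonoid_lattice F m K =
     \<lparr>carrier = {C. linearly_closed_clonoid F m K C}, eq = (=), le = (\<subseteq>)\<rparr>"

text \<open>
  The exponent is written \<open>n + i - h\<close> so that natural number subtraction agrees with the
  intended \<open>n - h + i\<close> for \<open>h \<le> n\<close>; for \<open>h > n\<close> the factor with \<open>i = h - n\<close> is zero.
\<close>

definition gauss_binomial :: "nat \<Rightarrow> nat \<Rightarrow> nat \<Rightarrow> real" where
  "gauss_binomial q n h = (\<Prod>i=1..h. (real q ^ (n + i - h) - 1) / (real q ^ i - 1))"

lemma ring_product_ring:
  assumes R: "\<And>i. i \<in> I \<Longrightarrow> ring (R i)"
  shows "ring (product_ring I R)"
proof -
  let ?P = "product_ring I R"
  have add: "\<And>x y. x \<oplus>\<^bsub>?P\<^esub> y = (\<lambda>i\<in>I. x i \<oplus>\<^bsub>R i\<^esub> y i)"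
    and mult: "\<And>x y. x \<otimes>\<^bsub>?P\<^esub> y = (\<lambda>i\<in>I. x i \<otimes>\<^bsub>R i\<^esub> y i)"
    and zero: "\<zero>\<^bsub>?P\<^esub> = (\<lambda>i\<in>I. \<zero>\<^bsub>R i\<^esub>)" and one: "\<one>\<^bsub>?P\<^esub> = (\<lambda>i\<in>I. \<one>\<^bsub>R i\<^esub>)"
    and car: "carrier ?P = (\<Pi>\<^sub>E i\<in>I. carrier (R i))"
    by (simp_all add: product_ring_def)
  have eqI: "x = y" if "x \<in> extensional I" "y \<in> extensional I" "\<And>i. i \<in> I \<Longrightarrow> x i = y i" for x y
    using that by (rule extensionalityI)
  note defs = add mult zero one car PiE_iff ring.ring_simprules[OF R] monoid.r_one[OF ring.is_monoid[OF R]]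
  have neg: "\<exists>y\<in>carrier ?P. y \<oplus>\<^bsub>?P\<^esub> x = \<zero>\<^bsub>?P\<^esub>" if x: "x \<in> carrier ?P" for x
    using x by (intro bexI[of _ "\<lambda>i\<in>I. \<ominus>\<^bsub>R i\<^esub> x i"] eqI) (simp_all add: defs)
  have "abelian_group ?P"
  proof (rule abelian_groupI)
    show "\<exists>y\<in>carrier ?P. y \<oplus>\<^bsub>?P\<^esub> x = \<zero>\<^bsub>?P\<^esub>" if "x \<in> carrier ?P" for x
      using that by (rule neg)
  qed ((rule eqI)?, simp_all add: defs)+
  moreover have "Group.monoid ?P"
    by (rule monoidI) ((rule eqI)?, simp_all add: defs)+
  ultimately show ?thesis
    by (rule ringI) ((rule eqI)?, simp_all add: defs)+
qed

lemma complete_lattice_clonoid_lattice: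
  assumes F: "ring F" and K: "\<And>j. j \<in> {1..m} \<Longrightarrow> ring (K j)"
  shows "complete_lattice (clonoid_lattice F m K)"
proof -
  interpret F: ring F by (rule F)
  let ?L = "clonoid_lattice F m K"
  let ?cl = "linearly_closed_clonoid F m K"
  let ?top = "{(k, f). 1 \<le> k \<and> f \<in> kary_functions F m K k}"
  have po: "partial_order ?L"
    by unfold_locales (auto simp: clonoid_lattice_def)
  have arg: "(\<lambda>j\<in>{1..m}. mat_vec (K j) n l (A j) (x j)) \<in> arg_space m K n"
    if "A \<in> (\<Pi>\<^sub>E j\<in>{1..m}. matrices (K j) n l)" "x \<in> arg_space m K l" for A x n l
  proof -
    have "mat_vec (K j) n l (A j) (x j) \<in> (\<Pi>\<^sub>E t\<in>{1..n}. carrier (K j))" if j: "j \<in> {1..m}" for j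
    proof -
      interpret Kj: ring "K j" using K[OF j] .
      have "A j \<in> matrices (K j) n l" "x j \<in> (\<Pi>\<^sub>E t\<in>{1..l}. carrier (K j))"
        using \<open>A \<in> _\<close> \<open>x \<in> _\<close> j by (auto simp: arg_space_def dest: PiE_mem)
      then show ?thesis
        unfolding mat_vec_def matrices_def
        by (intro restrict_PiE_iff[THEN iffD2] ballI Kj.finsum_closed Pi_I Kj.m_closed)
           (auto simp: PiE_iff)
    qed
    then show ?thesis by (auto simp: arg_space_def)
  qed
  have zero: "(k, \<lambda>x\<in>arg_space m K k. \<zero>\<^bsub>F\<^esub>) \<in> C" if C: "?cl C" and k: "1 \<le> k" for C k
  proof -
    obtain n f where nf: "(n, f) \<in> C" using C by (auto simp: linearly_closed_clonoid_def)
    then have n: "1 \<le> n" and f: "f \<in> kary_functions F m K n"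
      using C by (auto simp: linearly_closed_clonoid_def)
    have lin: "\<forall>a\<in>carrier F. \<forall>b\<in>carrier F. \<forall>f\<in>arity_part C n. \<forall>g\<in>arity_part C n.
        (\<lambda>x\<in>arg_space m K n. (a \<otimes>\<^bsub>F\<^esub> f x) \<oplus>\<^bsub>F\<^esub> (b \<otimes>\<^bsub>F\<^esub> g x)) \<in> arity_part C n"
      and sub: "\<And>f A. \<lbrakk>f \<in> arity_part C n; A \<in> (\<Pi>\<^sub>E j\<in>{1..m}. matrices (K j) n k)\<rbrakk> \<Longrightarrow>
        (\<lambda>x\<in>arg_space m K k. f (\<lambda>j\<in>{1..m}. mat_vec (K j) n k (A j) (x j))) \<in> arity_part C k"
      using C n k unfolding linearly_closed_clonoid_def by blast+
    have "(\<lambda>x\<in>arg_space m K n. (\<zero>\<^bsub>F\<^esub> \<otimes>\<^bsub>F\<^esub> f x) \<oplus>\<^bsub>F\<^esub> (\<zero>\<^bsub>F\<^esub> \<otimes>\<^bsub>F\<^esub> f x)) \<in> arity_part C n"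
      using lin nf by (auto simp: arity_part_def)
    also have "(\<lambda>x\<in>arg_space m K n. (\<zero>\<^bsub>F\<^esub> \<otimes>\<^bsub>F\<^esub> f x) \<oplus>\<^bsub>F\<^esub> (\<zero>\<^bsub>F\<^esub> \<otimes>\<^bsub>F\<^esub> f x))
        = (\<lambda>x\<in>arg_space m K n. \<zero>\<^bsub>F\<^esub>)"
      using f by (intro restrict_ext) (auto simp: kary_functions_def dest!: PiE_mem)
    finally have z: "(\<lambda>x\<in>arg_space m K n. \<zero>\<^bsub>F\<^esub>) \<in> arity_part C n" .
    define A where "A = (\<lambda>j\<in>{1..m}. \<lambda>r\<in>{1..n}. \<lambda>t\<in>{1..k}. \<zero>\<^bsub>K j\<^esub>)"
    have A: "A \<in> (\<Pi>\<^sub>E j\<in>{1..m}. matrices (K j) n k)"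
      using K by (auto simp: A_def matrices_def intro!: ring.ring_simprules)
    have "(\<lambda>x\<in>arg_space m K k. (\<lambda>x\<in>arg_space m K n. \<zero>\<^bsub>F\<^esub>)
            (\<lambda>j\<in>{1..m}. mat_vec (K j) n k (A j) (x j))) = (\<lambda>x\<in>arg_space m K k. \<zero>\<^bsub>F\<^esub>)"
      using arg[OF A] by (intro restrict_ext) simp
    with sub[OF z A] show ?thesis by (simp add: arity_part_def)
  qed
  have top: "?cl ?top"
  proof -
    have "(1, \<lambda>x\<in>arg_space m K 1. \<zero>\<^bsub>F\<^esub>) \<in> ?top"
      by (auto simp: kary_functions_def)
    then have ne: "?top \<noteq> {}" by blast
    have part: "arity_part ?top k = kary_functions F m K k" if "1 \<le> k" for k
      using that by (simp add: arity_part_def)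
    have val: "f x \<in> carrier F" if "f \<in> kary_functions F m K k" "x \<in> arg_space m K k" for f x k
      using that unfolding kary_functions_def by (rule PiE_mem)
    have mem: "restrict h (arg_space m K k) \<in> kary_functions F m K k"
      if "\<And>x. x \<in> arg_space m K k \<Longrightarrow> h x \<in> carrier F" for h k
      using that by (simp add: kary_functions_def)
    show ?thesis
      unfolding linearly_closed_clonoid_def
    proof (intro conjI allI impI ballI, goal_cases)
      case 1
      show ?case by (rule ne)
    next
      case (2 kf)
      then show ?case by auto
    next
      case (3 n a b f g)
      then show ?case
        unfolding part[OF 3(1)] by (intro mem F.a_closed F.m_closed val[of f n] val[of g n] 3(2,3))
    next
      case (4 l n f A)
      then show ?case
        unfolding part[OF 4(1)] part[OF 4(2)] by (intro mem val[of f n] arg)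
    qed
  qed
  have Inter: "?cl (\<Inter>A)" if A: "\<And>C. C \<in> A \<Longrightarrow> ?cl C" "A \<noteq> {}" for A
  proof -
    have "(1, \<lambda>x\<in>arg_space m K 1. \<zero>\<^bsub>F\<^esub>) \<in> \<Inter>A"
      using zero A(1) by auto
    then have ne: "\<Inter>A \<noteq> {}" by blast
    obtain C0 where C0: "C0 \<in> A" using A(2) by blast
    have part: "arity_part (\<Inter>A) k = (\<Inter>C\<in>A. arity_part C k)" for k
      by (auto simp: arity_part_def)
    note cl = A(1)[unfolded linearly_closed_clonoid_def]
    show ?thesis
      unfolding linearly_closed_clonoid_def part
    proof (intro conjI allI impI ballI INT_I, goal_cases)
      case 1
      show ?case by (rule ne)
    next
      case (2 kf)
      then have "kf \<in> C0" using C0 by blast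
      with cl[OF C0] show ?case by blast
    next
      case (3 n a b f g C)
      then have "f \<in> arity_part C n" "g \<in> arity_part C n" by blast+
      with cl[OF 3(6)] 3(1-3) show ?case by simp
    next
      case (4 l n f A' C)
      then have "f \<in> arity_part C n" by blast
      with cl[OF 4(5)] 4(1,2,4) show ?case by simp
    qed
  qed
  show ?thesis
  proof (rule partial_order.complete_lattice_criterion1[OF po])
    have "greatest ?L ?top (carrier ?L)"
      using top by (auto simp: greatest_def clonoid_lattice_def linearly_closed_clonoid_def)
    then show "\<exists>g. greatest ?L g (carrier ?L)" ..
  next
    fix A assume A: "A \<subseteq> carrier ?L" "A \<noteq> {}"
    then have "?cl (\<Inter>A)" by (intro Inter) (auto simp: clonoid_lattice_def)
    with A have "greatest ?L (\<Inter>A) (Lower ?L A)"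
      by (auto simp: greatest_def Lower_def clonoid_lattice_def)
    then show "\<exists>i. greatest ?L i (Lower ?L A)" ..
  qed
qed

end

theory Submission
  imports Defs "HOL-Algebra.Multiplicative_Group"
begin

text \<open>
Write \<open>\<K>\<close> and \<open>\<F>\<close> for the two products of fields. A clonoid is determined by its unary part, and
the unary part, a submodule of \<open>\<F>\<^sup>\<K>\<close>, splits into one subspace of \<open>F\<^sub>i\<^sup>n\<close> for each factor \<open>F\<^sub>i\<close>
of \<open>\<F>\<close>, where \<open>n = |\<K>|\<close>. The bound then counts subspaces.

That the unary part suffices rests on an identity in the monoid of square matrices over a field
\<open>R\<close> with \<open>q\<close> elements. For a function \<open>g\<close> on \<open>R\<^sup>k\<close> with \<open>g(0) = 0\<close> and every vector \<open>v\<close>,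

\<open>q\<^sup>k\<^sup>-\<^sup>1 g(v) = (\<Sum>L rank one, trace 1. g(L v)) - (\<Sum>L rank one, trace 0. g(L v))\<close>

(lemma \<open>rank_one_inversion\<close>). The reason is a count: the rank-one maps sending \<open>v\<close> to \<open>w \<noteq> 0\<close> are the
\<open>w a\<^sup>T\<close> with \<open>a \<bullet> v = 1\<close>, their trace is \<open>a \<bullet> w\<close>, and the values \<open>1\<close> and \<open>0\<close> of \<open>a \<bullet> w\<close> are equally
frequent unless \<open>w = v\<close>. Since \<open>q\<close> is coprime to the order of the codomain, the factor \<open>q\<^sup>k\<^sup>-\<^sup>1\<close> can
be cancelled. Applied to each vector argument in turn, this writes a \<open>k\<close>-ary function \<open>f\<close> as a linear
combination of functions that arise from \<open>f\<close> by substituting rank-one matrices \<open>b a\<^sup>T\<close>. Each of these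
comes from a unary function: the columns \<open>b\<close> reduce \<open>f\<close> to arity one, and the rows \<open>a\<close> lead back to
arity \<open>k\<close>. Hence \<open>f\<close> belongs to a clonoid as soon as its unary minors do
(lemmas \<open>rank_one_reduction\<close> and \<open>unary_minors_determine\<close>).

Subspaces of \<open>R\<^sup>n\<close> are counted by induction on \<open>n\<close>: with respect to a chosen coordinate, a subspace is
given by the subspace of its vectors with entry \<open>0\<close> there and, unless this is everything, the coset
formed by the vectors with entry \<open>1\<close>. This yields the Pascal rule of the Gaussian binomials
(lemma \<open>card_fun_submodules_dim\<close>). The total over all dimensions includes the summand \<open>1\<close> for
dimension \<open>0\<close>, which the bound omits. It is saved because one subspace never occurs: the line spanned
by the indicator function of \<open>0\<close> is not closed under substituting the zero matrix
(lemma \<open>coordinate_image_ne_supported_at\<close>).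
\<close>

section \<open>Gaussian binomial coefficients\<close>

lemma gauss_binomial_0: "gauss_binomial q n 0 = 1"
  by (simp add: gauss_binomial_def)

lemma gauss_binomial_eq_0:
  assumes "n < h"
  shows "gauss_binomial q n h = 0"
proof -
  have "h - n \<in> {1..h}" and "real q ^ (n + (h - n) - h) - 1 = 0" using assms by auto
  then show ?thesis unfolding gauss_binomial_def
    by (intro prod_zero) (auto intro!: bexI[of _ "h - n"])
qed

text \<open>
Of the two \<open>q\<close>-Pascal rules this is the one that matches splitting off a coordinate of
\<open>R\<^sup>n\<^sup>+\<^sup>1\<close>: the first summand counts the subspaces on which the coordinate vanishes, and in the
second a subspace \<open>U\<close> of dimension \<open>r\<close> is combined with one of its \<open>q\<^sup>n\<^sup>-\<^sup>r\<close> cosets.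
\<close>

lemma gauss_binomial_Pascal:
  assumes q: "2 \<le> q"
  shows "gauss_binomial q (Suc n) (Suc r)
    = gauss_binomial q n (Suc r) + real q ^ (n - r) * gauss_binomial q n r"
proof (cases "r \<le> n")
  case False
  then show ?thesis by (simp add: gauss_binomial_eq_0)
next
  case True
  define N where "N = (\<Prod>i=1..r. real q ^ (n + i - r) - 1)"
  define D where "D = (\<Prod>i=1..r. real q ^ i - 1)"
  have gt: "real q ^ Suc i > 1" for i using q by (intro one_less_power) auto
  have "real q ^ i - 1 \<noteq> 0" if "i \<in> {1..r}" for i
    using gt[of "i - 1"] that by (cases i) auto
  then have D: "D \<noteq> 0" unfolding D_def by (simp add: prod_zero_iff)
  have d: "real q ^ Suc r - 1 \<noteq> 0" using gt[of r] by linarith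
  have nr: "gauss_binomial q n r = N / D"
    by (simp add: gauss_binomial_def prod_dividef N_def D_def)
  \<comment> \<open>Both binomials are compared with \<open>gauss_binomial q n r\<close>: one gains a factor at the top of the numerator, the other at its bottom.\<close>
  have up: "gauss_binomial q (Suc n) (Suc r) = N * (real q ^ Suc n - 1) / (D * (real q ^ Suc r - 1))"
    by (simp add: gauss_binomial_def prod_dividef N_def D_def)
  have "(\<Prod>i=1..Suc r. real q ^ (n + i - Suc r) - 1)
      = (real q ^ (n - r) - 1) * (\<Prod>i=Suc 1..Suc r. real q ^ (n + i - Suc r) - 1)"
    by (subst prod.atLeast_Suc_atMost) auto
  also have "(\<Prod>i=Suc 1..Suc r. real q ^ (n + i - Suc r) - 1) = N"
    unfolding N_def by (subst prod.shift_bounds_cl_Suc_ivl) auto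
  finally have side: "gauss_binomial q n (Suc r)
      = (real q ^ (n - r) - 1) * N / (D * (real q ^ Suc r - 1))"
    by (simp add: gauss_binomial_def prod_dividef D_def)
  have "real q ^ Suc n = real q ^ (n - r) * real q ^ Suc r"
    using True by (simp flip: power_add)
  then show ?thesis
    using D d unfolding nr up side by (simp add: divide_simps) (simp add: algebra_simps)
qed

section \<open>Submodules of function modules\<close>

text \<open>
The \<open>R\<close>-submodules of the function module \<open>R\<^sup>X\<close>, with closure under binary linear combinations
taken in the shape in which it occurs in the definition of a clonoid. For a field \<open>R\<close> these are
the subspaces; for a product of fields the \<open>k\<close>-ary parts of clonoids are of this kind.
\<close>

definition fun_submodules :: "('b, 'y) ring_scheme \<Rightarrow> 'x set \<Rightarrow> ('x \<Rightarrow> 'b) set set" where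
  "fun_submodules R X = {W. W \<noteq> {} \<and> W \<subseteq> X \<rightarrow>\<^sub>E carrier R \<and>
     (\<forall>a\<in>carrier R. \<forall>b\<in>carrier R. \<forall>f\<in>W. \<forall>g\<in>W.
        (\<lambda>x\<in>X. (a \<otimes>\<^bsub>R\<^esub> f x) \<oplus>\<^bsub>R\<^esub> (b \<otimes>\<^bsub>R\<^esub> g x)) \<in> W)}"

lemma fun_submodules_mem:
  assumes "W \<in> fun_submodules R X" "f \<in> W" "x \<in> X"
  shows "f x \<in> carrier R"
  using assms by (auto simp: fun_submodules_def)

lemma fun_submodules_PiE: "W \<in> fun_submodules R X \<Longrightarrow> f \<in> W \<Longrightarrow> f \<in> X \<rightarrow>\<^sub>E carrier R"
  by (auto simp: fun_submodules_def)

lemma fun_submodules_ext: "W \<in> fun_submodules R X \<Longrightarrow> f \<in> W \<Longrightarrow> f \<in> extensional X"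
  by (drule (1) fun_submodules_PiE) (auto simp: PiE_def)

lemma fun_submodules_comb:
  assumes "W \<in> fun_submodules R X" "a \<in> carrier R" "b \<in> carrier R" "f \<in> W" "g \<in> W"
    and "h \<in> extensional X" "\<And>x. x \<in> X \<Longrightarrow> h x = (a \<otimes>\<^bsub>R\<^esub> f x) \<oplus>\<^bsub>R\<^esub> (b \<otimes>\<^bsub>R\<^esub> g x)"
  shows "h \<in> W"
proof -
  have "h = (\<lambda>x\<in>X. (a \<otimes>\<^bsub>R\<^esub> f x) \<oplus>\<^bsub>R\<^esub> (b \<otimes>\<^bsub>R\<^esub> g x))"
    using assms(6,7) by (intro extensionalityI[of _ X]) auto
  with assms show ?thesis by (auto simp: fun_submodules_def)
qed

lemma fun_submodules_add:
  assumes "ring R" "W \<in> fun_submodules R X" "f \<in> W" "g \<in> W"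
    and "h \<in> extensional X" "\<And>x. x \<in> X \<Longrightarrow> h x = f x \<oplus>\<^bsub>R\<^esub> g x"
  shows "h \<in> W"
proof -
  interpret ring R by fact
  show ?thesis
    using assms fun_submodules_mem[OF assms(2)]
    by (intro fun_submodules_comb[OF assms(2) one_closed one_closed assms(3,4)]) auto
qed

lemma fun_submodules_diff:
  assumes "ring R" "W \<in> fun_submodules R X" "f \<in> W" "g \<in> W"
    and "h \<in> extensional X" "\<And>x. x \<in> X \<Longrightarrow> h x = f x \<ominus>\<^bsub>R\<^esub> g x"
  shows "h \<in> W"
proof -
  interpret ring R by fact
  show ?thesis
    using assms fun_submodules_mem[OF assms(2)]
    by (intro fun_submodules_comb[OF assms(2) one_closed a_inv_closed[OF one_closed] assms(3,4)])
      (auto simp: l_minus a_minus_def)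
qed

lemma fun_submodules_zero:
  assumes "ring R" "W \<in> fun_submodules R X"
  shows "(\<lambda>x\<in>X. \<zero>\<^bsub>R\<^esub>) \<in> W"
proof -
  interpret ring R by fact
  obtain f where f: "f \<in> W" using assms by (auto simp: fun_submodules_def)
  show ?thesis
    using fun_submodules_mem[OF assms(2) f]
    by (intro fun_submodules_diff[OF assms f f]) (auto simp: a_minus_def r_neg)
qed

lemma fun_submodules_subgroup:
  assumes "ring R" and W: "W \<in> fun_submodules R X"
  shows "subgroup W (add_monoid (product_ring X (\<lambda>_. R)))" (is "subgroup W ?A")
proof -
  interpret R: ring R by fact
  interpret P: ring "product_ring X (\<lambda>_. R)" by (rule ring_product_ring) (rule assms(1))
  have sub: "W \<subseteq> X \<rightarrow>\<^sub>E carrier R" using W by (auto simp: fun_submodules_def)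
  show ?thesis
  proof (rule group.subgroupI[OF P.a_group])
    show "W \<subseteq> carrier ?A" using sub by (simp add: product_ring_def)
    show "W \<noteq> {}" using W by (auto simp: fun_submodules_def)
    show "f \<otimes>\<^bsub>?A\<^esub> g \<in> W" if "f \<in> W" "g \<in> W" for f g
      using that by (intro fun_submodules_add[OF assms that]) (auto simp: product_ring_def)
    show "inv\<^bsub>?A\<^esub> f \<in> W" if f: "f \<in> W" for f
    proof -
      define g where "g = (\<lambda>x\<in>X. \<ominus>\<^bsub>R\<^esub> f x)"
      have g: "g \<in> W" using fun_submodules_mem[OF W f] unfolding g_def
        by (intro fun_submodules_diff[OF assms fun_submodules_zero[OF assms] f])
          (auto simp: R.minus_eq)
      have "inv\<^bsub>?A\<^esub> f = g"
        using f g sub fun_submodules_mem[OF W f] by (intro group.inv_equality[OF P.a_group])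
          (auto simp: product_ring_def g_def R.l_neg)
      with g show ?thesis by simp
    qed
  qed
qed

text \<open>
Lagrange's theorem in the additive group of \<open>R\<^sup>X\<close>.
\<close>

lemma card_cosets_fun_submodule:
  assumes "ring R" "finite (carrier R)" "finite X" and W: "W \<in> fun_submodules R X"
  shows "card (rcosets\<^bsub>add_monoid (product_ring X (\<lambda>_. R))\<^esub> W) * card W = order R ^ card X"
proof -
  interpret P: ring "product_ring X (\<lambda>_. R)" by (rule ring_product_ring) (rule assms(1))
  have "order (add_monoid (product_ring X (\<lambda>_. R))) = order R ^ card X"
    using assms by (simp add: order_def product_ring_def card_PiE)
  then show ?thesis
    using group.lagrange[OF P.a_group fun_submodules_subgroup[OF assms(1) W]] by simp
qed

section \<open>Counting subspaces over a finite field\<close>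

text \<open>
The fibre of \<open>W\<close> over the value \<open>c\<close> at the point \<open>x0\<close>, seen as a set of functions on the remaining
points. A subspace \<open>W\<close> is recovered from its fibres over \<open>0\<close> and \<open>1\<close>: the former is a subspace
\<open>U\<close>, and the latter is empty or a coset of \<open>U\<close>.
\<close>

definition slice :: "'x set \<Rightarrow> 'x \<Rightarrow> ('x \<Rightarrow> 'b) set \<Rightarrow> 'b \<Rightarrow> ('x \<Rightarrow> 'b) set" where
  "slice X x0 W c = {restrict f X | f. f \<in> W \<and> f x0 = c}"

context
  fixes R :: "('b, 'y) ring_scheme" (structure) and X :: "'x set" and x0 :: 'x
  assumes field: "field R" and fresh: "x0 \<notin> X"
begin

interpretation field R by (rule field)

private lemma ring_R: "ring R" by unfold_locales

lemma slice_zero_submodule: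
  assumes W: "W \<in> fun_submodules R (insert x0 X)"
  shows "slice X x0 W \<zero> \<in> fun_submodules R X"
proof -
  note mem = fun_submodules_mem[OF W]
  define z where "z = (\<lambda>x\<in>insert x0 X. \<zero>)"
  have "z \<in> W" "z x0 = \<zero>" using fun_submodules_zero[OF ring_R W] by (simp_all add: z_def)
  then have "restrict z X \<in> slice X x0 W \<zero>" by (auto simp: slice_def)
  moreover have "slice X x0 W \<zero> \<subseteq> X \<rightarrow>\<^sub>E carrier R"
    using mem by (auto simp: slice_def)
  moreover have "(\<lambda>x\<in>X. (a \<otimes> f x) \<oplus> (b \<otimes> g x)) \<in> slice X x0 W \<zero>"
    if ab: "a \<in> carrier R" "b \<in> carrier R" and fg: "f \<in> slice X x0 W \<zero>" "g \<in> slice X x0 W \<zero>" for a b f g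
  proof -
    obtain f' g' where f': "f' \<in> W" "f' x0 = \<zero>" "f = restrict f' X"
      and g': "g' \<in> W" "g' x0 = \<zero>" "g = restrict g' X"
      using fg by (auto simp: slice_def)
    define h where "h = (\<lambda>x\<in>insert x0 X. (a \<otimes> f' x) \<oplus> (b \<otimes> g' x))"
    have "h \<in> W" by (rule fun_submodules_comb[OF W ab f'(1) g'(1)]) (auto simp: h_def)
    moreover have "h x0 = \<zero>" using f' g' ab by (simp add: h_def)
    moreover have "(\<lambda>x\<in>X. (a \<otimes> f x) \<oplus> (b \<otimes> g x)) = restrict h X"
      using f' g' by (auto simp: h_def fun_eq_iff)
    ultimately show ?thesis by (auto simp: slice_def)
  qed
  ultimately show ?thesis by (auto simp: fun_submodules_def)
qed

text \<open>
A function of \<open>W\<close> with a non-zero value at \<open>x0\<close> could be rescaled to take the value \<open>1\<close> there.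
\<close>

lemma submodule_vanishing:
  assumes W: "W \<in> fun_submodules R (insert x0 X)" and "slice X x0 W \<one> = {}" and f: "f \<in> W"
  shows "f x0 = \<zero>"
proof (rule ccontr)
  assume "f x0 \<noteq> \<zero>"
  moreover have c: "f x0 \<in> carrier R" using fun_submodules_mem[OF W f] by simp
  ultimately have u: "f x0 \<in> Units R" by (simp add: field_Units)
  define h where "h = (\<lambda>x\<in>insert x0 X. (inv (f x0) \<otimes> f x) \<oplus> (\<zero> \<otimes> f x))"
  have "h \<in> W" using u by (intro fun_submodules_comb[OF W _ _ f f]) (auto simp: h_def)
  moreover have "h x0 = \<one>" using u c by (simp add: h_def)
  ultimately show False using assms(2) by (auto simp: slice_def)
qed

lemma submodule_le_of_slices:
  assumes W: "W \<in> fun_submodules R (insert x0 X)" and "slice X x0 W \<one> = {}"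
    and W': "W' \<in> fun_submodules R (insert x0 X)" and "slice X x0 W' \<one> = {}"
    and eq: "slice X x0 W \<zero> = slice X x0 W' \<zero>"
  shows "W \<subseteq> W'"
proof
  fix f assume f: "f \<in> W"
  then have "restrict f X \<in> slice X x0 W' \<zero>"
    using submodule_vanishing[OF assms(1,2) f] eq by (auto simp: slice_def)
  then obtain f' where f': "f' \<in> W'" "f' x0 = \<zero>" "restrict f X = restrict f' X"
    by (auto simp: slice_def)
  have "f = f'"
  proof (rule extensionalityI[of _ "insert x0 X"])
    show "f \<in> extensional (insert x0 X)" "f' \<in> extensional (insert x0 X)"
      using fun_submodules_ext[OF W f] fun_submodules_ext[OF W' f'(1)] by auto
    show "f x = f' x" if "x \<in> insert x0 X" for x
      using that f'(2,3) submodule_vanishing[OF assms(1,2) f] by (metis insertE restrict_apply')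
  qed
  with f' show "f \<in> W'" by simp
qed

lemma card_slice_empty:
  assumes W: "W \<in> fun_submodules R (insert x0 X)" and "slice X x0 W \<one> = {}"
  shows "card W = card (slice X x0 W \<zero>)"
proof -
  have "slice X x0 W \<zero> = (\<lambda>f. restrict f X) ` W"
    using submodule_vanishing[OF assms] by (auto simp: slice_def)
  moreover have "inj_on (\<lambda>f. restrict f X) W"
  proof (rule inj_onI)
    fix f g assume fg: "f \<in> W" "g \<in> W" "restrict f X = restrict g X"
    show "f = g"
    proof (rule extensionalityI[of _ "insert x0 X"])
      show "f \<in> extensional (insert x0 X)" "g \<in> extensional (insert x0 X)"
        using fun_submodules_ext[OF W] fg by auto
      show "f x = g x" if "x \<in> insert x0 X" for x
        using that fg submodule_vanishing[OF assms] by (metis insertE restrict_apply')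
    qed
  qed
  ultimately show ?thesis by (simp add: card_image)
qed

text \<open>
Membership in \<open>W\<close> can be tested after subtracting the multiple of \<open>g\<close> that cancels the value at
\<open>x0\<close>. Hence \<open>W\<close> is determined by its fibre over \<open>0\<close> and any one function \<open>g\<close>.
\<close>

lemma submodule_decompose:
  assumes W: "W \<in> fun_submodules R (insert x0 X)" and g: "g \<in> W" "g x0 = \<one>"
    and f: "f \<in> insert x0 X \<rightarrow>\<^sub>E carrier R"
  shows "f \<in> W \<longleftrightarrow> (\<lambda>x\<in>X. f x \<ominus> f x0 \<otimes> g x) \<in> slice X x0 W \<zero>"
proof
  have c: "f x0 \<in> carrier R" using f by auto
  note gm = fun_submodules_mem[OF W g(1)]
  {
    assume "f \<in> W"
    define h where "h = (\<lambda>x\<in>insert x0 X. f x \<ominus> f x0 \<otimes> g x)"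
    have "f x \<in> carrier R" if "x \<in> insert x0 X" for x using f that by (rule PiE_mem)
    then have "h \<in> W" using c gm
      by (intro fun_submodules_comb[OF W one_closed a_inv_closed[OF c] \<open>f \<in> W\<close> g(1)])
        (auto simp: h_def l_minus a_minus_def)
    moreover have "h x0 = \<zero>" using c g by (simp add: h_def a_minus_def r_neg)
    moreover have "restrict h X = (\<lambda>x\<in>X. f x \<ominus> f x0 \<otimes> g x)" by (auto simp: h_def fun_eq_iff)
    ultimately show "(\<lambda>x\<in>X. f x \<ominus> f x0 \<otimes> g x) \<in> slice X x0 W \<zero>" by (auto simp: slice_def intro!: exI[of _ h])
  }
  {
    assume "(\<lambda>x\<in>X. f x \<ominus> f x0 \<otimes> g x) \<in> slice X x0 W \<zero>"
    then obtain h where h: "h \<in> W" "h x0 = \<zero>" "(\<lambda>x\<in>X. f x \<ominus> f x0 \<otimes> g x) = restrict h X"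
      by (auto simp: slice_def)
    have hx: "h x = f x \<ominus> f x0 \<otimes> g x" if "x \<in> X" for x
      using fun_cong[OF h(3), of x] that by simp
    show "f \<in> W"
    proof (rule fun_submodules_comb[OF W one_closed c h(1) g(1)])
      show "f \<in> extensional (insert x0 X)" using f by (auto simp: PiE_def)
      show "f x = (\<one> \<otimes> h x) \<oplus> (f x0 \<otimes> g x)" if "x \<in> insert x0 X" for x
      proof (cases "x = x0")
        case True with h g c show ?thesis by simp
      next
        case False
        with that have x: "x \<in> X" by simp
        have "f x \<in> carrier R" "g x \<in> carrier R" using x f gm by auto
        with c show ?thesis by (simp add: hx[OF x] a_minus_def a_assoc l_neg)
      qed
    qed
  }
qed

lemma slice_one_coset:
  assumes W: "W \<in> fun_submodules R (insert x0 X)" and "slice X x0 W \<one> \<noteq> {}"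
  shows "slice X x0 W \<one> \<in> rcosets\<^bsub>add_monoid (product_ring X (\<lambda>_. R))\<^esub> (slice X x0 W \<zero>)"
proof -
  obtain g where g: "g \<in> W" "g x0 = \<one>" using assms(2) by (auto simp: slice_def)
  note gm = fun_submodules_mem[OF W g(1)]
  let ?C = "slice X x0 W \<zero> #>\<^bsub>add_monoid (product_ring X (\<lambda>_. R))\<^esub> restrict g X"
  have "slice X x0 W \<one> = ?C"
  proof (intro Set.set_eqI iffI)
    fix k assume "k \<in> slice X x0 W \<one>"
    then obtain f where f: "f \<in> W" "f x0 = \<one>" "k = restrict f X" by (auto simp: slice_def)
    note fm = fun_submodules_mem[OF W f(1)]
    define u where "u = (\<lambda>x\<in>X. f x \<ominus> f x0 \<otimes> g x)"
    have "f \<in> insert x0 X \<rightarrow>\<^sub>E carrier R" using f W by (auto simp: fun_submodules_def)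
    then have "u \<in> slice X x0 W \<zero>" using submodule_decompose[OF W g] f unfolding u_def by blast
    moreover have "k = (\<lambda>x\<in>X. u x \<oplus> restrict g X x)"
      unfolding f(3) using fm gm f(2)
      by (intro restrict_ext) (auto simp: u_def a_minus_def a_assoc l_neg)
    ultimately show "k \<in> ?C" by (auto simp: r_coset_def product_ring_def)
  next
    fix k assume "k \<in> ?C"
    then obtain u where u: "u \<in> slice X x0 W \<zero>" "k = (\<lambda>x\<in>X. u x \<oplus> restrict g X x)"
      by (auto simp: r_coset_def product_ring_def)
    then obtain f where f: "f \<in> W" "f x0 = \<zero>" "u = restrict f X" by (auto simp: slice_def)
    define h where "h = (\<lambda>x\<in>insert x0 X. f x \<oplus> g x)"
    have "h \<in> W" by (rule fun_submodules_add[OF ring_R W f(1) g(1)]) (auto simp: h_def)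
    moreover have "h x0 = \<one>" using f g by (simp add: h_def)
    moreover have "k = restrict h X" unfolding u(2) f(3) by (auto simp: h_def fun_eq_iff)
    ultimately show "k \<in> slice X x0 W \<one>" by (auto simp: slice_def)
  qed
  moreover have "restrict g X \<in> carrier (add_monoid (product_ring X (\<lambda>_. R)))"
    using gm by (auto simp: product_ring_def)
  ultimately show ?thesis by (auto simp: RCOSETS_def)
qed

lemma slices_determine:
  assumes W: "W \<in> fun_submodules R (insert x0 X)" and W': "W' \<in> fun_submodules R (insert x0 X)"
    and ne: "slice X x0 W \<one> \<noteq> {}"
    and eq: "slice X x0 W \<zero> = slice X x0 W' \<zero>" "slice X x0 W \<one> = slice X x0 W' \<one>"
  shows "W = W'"
proof -
  obtain g where g: "g \<in> W" "g x0 = \<one>" using ne by (auto simp: slice_def)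
  then have "restrict g X \<in> slice X x0 W' \<one>" using eq(2) by (auto simp: slice_def)
  then obtain g' where g': "g' \<in> W'" "g' x0 = \<one>" "restrict g X = restrict g' X"
    by (auto simp: slice_def)
  have gg: "g x = g' x" if "x \<in> X" for x using g'(3) that by (metis restrict_apply')
  have "f \<in> W \<longleftrightarrow> f \<in> W'" if f: "f \<in> insert x0 X \<rightarrow>\<^sub>E carrier R" for f
  proof -
    have "(\<lambda>x\<in>X. f x \<ominus> f x0 \<otimes> g x) = (\<lambda>x\<in>X. f x \<ominus> f x0 \<otimes> g' x)"
      using gg by (intro restrict_ext) simp
    then show ?thesis
      using submodule_decompose[OF W g f] submodule_decompose[OF W' g'(1,2) f] eq(1) by simp
  qed
  then show ?thesis
    using fun_submodules_PiE[OF W] fun_submodules_PiE[OF W'] by (intro Set.set_eqI) metis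
qed

text \<open>
\<open>W\<close> is the direct sum of its fibre over \<open>0\<close> and the line spanned by a function that takes the
value \<open>1\<close> at \<open>x0\<close>.
\<close>

lemma card_slice_nonempty:
  assumes W: "W \<in> fun_submodules R (insert x0 X)" and ne: "slice X x0 W \<one> \<noteq> {}"
  shows "card W = order R * card (slice X x0 W \<zero>)"
proof -
  obtain g where g: "g \<in> W" "g x0 = \<one>" using ne by (auto simp: slice_def)
  note gm = fun_submodules_mem[OF W g(1)]
  let ?\<phi> = "\<lambda>f. (f x0, \<lambda>x\<in>X. f x \<ominus> f x0 \<otimes> g x)"
  let ?\<psi> = "\<lambda>(c, u). (\<lambda>x\<in>insert x0 X. if x = x0 then c else u x \<oplus> c \<otimes> g x)"
  have Wsub: "W \<subseteq> insert x0 X \<rightarrow>\<^sub>E carrier R" using W by (auto simp: fun_submodules_def)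
  have usub: "slice X x0 W \<zero> \<subseteq> X \<rightarrow>\<^sub>E carrier R"
    using slice_zero_submodule[OF W] by (auto simp: fun_submodules_def)
  have cancel: "(a \<oplus> b) \<ominus> b = a" "(a \<ominus> b) \<oplus> b = a" if "a \<in> carrier R" "b \<in> carrier R" for a b
    using that by (simp_all add: a_minus_def a_assoc r_neg l_neg)
  have \<psi>: "?\<psi> (c, u) \<in> insert x0 X \<rightarrow>\<^sub>E carrier R" and \<phi>\<psi>: "?\<phi> (?\<psi> (c, u)) = (c, u)"
    if cu: "c \<in> carrier R" "u \<in> X \<rightarrow>\<^sub>E carrier R" for c u
  proof -
    have ux: "u x \<in> carrier R" if "x \<in> X" for x using cu(2) that by (rule PiE_mem)
    show "?\<psi> (c, u) \<in> insert x0 X \<rightarrow>\<^sub>E carrier R" using cu(1) gm ux by auto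
    show "?\<phi> (?\<psi> (c, u)) = (c, u)"
      using cu gm ux fresh by (auto simp: fun_eq_iff cancel PiE_def extensional_def)
  qed
  have "bij_betw ?\<phi> W (carrier R \<times> slice X x0 W \<zero>)"
  proof (rule bij_betw_byWitness[where f' = ?\<psi>])
    show "\<forall>f\<in>W. ?\<psi> (?\<phi> f) = f"
    proof
      fix f assume "f \<in> W"
      then have "f \<in> insert x0 X \<rightarrow>\<^sub>E carrier R" using Wsub by auto
      then have "f \<in> extensional (insert x0 X)" "\<And>x. x \<in> insert x0 X \<Longrightarrow> f x \<in> carrier R"
        by (auto simp: PiE_def)
      then show "?\<psi> (?\<phi> f) = f"
        using gm by (intro extensionalityI[of _ "insert x0 X"]) (auto simp: cancel PiE_def)
    qed
    show "\<forall>z\<in>carrier R \<times> slice X x0 W \<zero>. ?\<phi> (?\<psi> z) = z" using \<phi>\<psi> usub by blast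
    show "?\<phi> ` W \<subseteq> carrier R \<times> slice X x0 W \<zero>"
      using Wsub submodule_decompose[OF W g] by blast
    show "?\<psi> ` (carrier R \<times> slice X x0 W \<zero>) \<subseteq> W"
    proof
      fix f assume "f \<in> ?\<psi> ` (carrier R \<times> slice X x0 W \<zero>)"
      then obtain c u where cu: "c \<in> carrier R" "u \<in> slice X x0 W \<zero>" and f: "f = ?\<psi> (c, u)"
        by blast
      then have u: "u \<in> X \<rightarrow>\<^sub>E carrier R" using usub by auto
      have "snd (?\<phi> (?\<psi> (c, u))) \<in> slice X x0 W \<zero>" using \<phi>\<psi>[OF cu(1) u] cu(2) by simp
      then have "(\<lambda>x\<in>X. ?\<psi> (c, u) x \<ominus> ?\<psi> (c, u) x0 \<otimes> g x) \<in> slice X x0 W \<zero>"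
        by simp
      then show "f \<in> W"
        unfolding f using submodule_decompose[OF W g \<psi>[OF cu(1) u]] by blast
    qed
  qed
  then show ?thesis by (simp add: bij_betw_same_card card_cartesian_product order_def)
qed

end

lemma finite_fun_submodules:
  assumes "finite (carrier R)" "finite X"
  shows "finite (fun_submodules R X)"
proof (rule finite_subset)
  show "fun_submodules R X \<subseteq> Pow (X \<rightarrow>\<^sub>E carrier R)" by (auto simp: fun_submodules_def)
  show "finite (Pow (X \<rightarrow>\<^sub>E carrier R))" using assms by (simp add: finite_PiE)
qed

text \<open>
The exponent \<open>r\<close> is the dimension. Subspaces of dimension \<open>r\<close> are recognised below by their
cardinality, which avoids bases.
\<close>

lemma card_fun_submodule:
  assumes "field R" "finite (carrier R)" "finite X" "W \<in> fun_submodules R X"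
  shows "\<exists>r\<le>card X. card W = order R ^ r"
  using assms(3,4)
proof (induction X arbitrary: W rule: finite_induct)
  case empty
  then have "W = {\<lambda>_. undefined}" by (auto simp: fun_submodules_def)
  then show ?case by simp
next
  case (insert x X)
  let ?U = "slice X x W \<zero>\<^bsub>R\<^esub>"
  obtain r where r: "r \<le> card X" "card ?U = order R ^ r"
    using insert.IH[OF slice_zero_submodule[OF assms(1) insert.hyps(2) insert.prems]] by blast
  show ?case
  proof (cases "slice X x W \<one>\<^bsub>R\<^esub> = {}")
    case True
    then have "card W = order R ^ r"
      using card_slice_empty[OF assms(1) insert.hyps(2) insert.prems] r by simp
    with r insert.hyps show ?thesis by (intro exI[of _ r]) simp
  next
    case False
    then have "card W = order R ^ Suc r"
      using card_slice_nonempty[OF assms(1) insert.hyps(2) insert.prems] r by simp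
    with r insert.hyps show ?thesis by (intro exI[of _ "Suc r"]) simp
  qed
qed

text \<open>
Splitting off a point \<open>x\<close>, the map
sending \<open>W\<close> to its fibres over \<open>0\<close> and \<open>1\<close> is injective; the subspaces vanishing at \<open>x\<close> contribute
at most as many as there are subspaces of the same size for \<open>X\<close>, and the others at most one for
each pair of a subspace of dimension one less and a coset of it.
\<close>

lemma card_fun_submodules_dim:
  fixes R :: "('b, 'y) ring_scheme" and X :: "'x set"
  assumes R: "field R" "finite (carrier R)" and "finite X"
  shows "real (card {W \<in> fun_submodules R X. card W = order R ^ r})
    \<le> gauss_binomial (order R) (card X) r"
proof -
  interpret R: field R by fact
  have ringR: "ring R" by unfold_locales
  have q: "2 \<le> order R"
  proof -
    have "card {\<zero>\<^bsub>R\<^esub>, \<one>\<^bsub>R\<^esub>} \<le> card (carrier R)" using R(2) by (intro card_mono) auto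
    then show ?thesis by (simp add: order_def)
  qed
  let ?D = "\<lambda>(X :: 'x set) r. {W \<in> fun_submodules R X. card W = order R ^ r}"
  show ?thesis
    using \<open>finite X\<close>
  proof (induction X arbitrary: r rule: finite_induct)
    case empty
    have sub: "fun_submodules R ({} :: 'x set) \<subseteq> {{\<lambda>_. undefined}}"
      by (auto simp: fun_submodules_def)
    show ?case
    proof (cases r)
      case 0
      have "card (?D {} 0) \<le> card {{\<lambda>_::'x. undefined :: 'b}}"
        using sub by (intro card_mono) auto
      then show ?thesis using 0 by (simp add: gauss_binomial_0)
    next
      case (Suc n)
      have "order R ^ Suc n > 1" using q by (intro one_less_power) auto
      then have "?D {} (Suc n) = {}" using sub by fastforce
      then have "card (?D {} (Suc n)) = 0" by (simp only: card.empty)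
      then show ?thesis unfolding Suc by (simp add: gauss_binomial_eq_0)
    qed
  next
    case (insert x X)
    note sl = slice_zero_submodule[OF R(1) insert.hyps(2)]
    have finX: "finite (?D X r)" for r
      by (rule finite_subset[OF _ finite_fun_submodules[OF R(2) insert.hyps(1)]]) auto
    have finI: "finite (?D (insert x X) r)" for r
      by (rule finite_subset[OF _ finite_fun_submodules[OF R(2) finite.insertI[OF insert.hyps(1)]]]) auto
    \<comment> \<open>\<open>?E\<close>: the subspaces all of whose functions vanish at \<open>x\<close>; \<open>?N\<close>: the others.\<close>
    let ?E = "\<lambda>r. {W \<in> ?D (insert x X) r. slice X x W \<one>\<^bsub>R\<^esub> = {}}"
    let ?N = "\<lambda>r. {W \<in> ?D (insert x X) r. slice X x W \<one>\<^bsub>R\<^esub> \<noteq> {}}"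
    have E: "card (?E r) \<le> card (?D X r)" for r
    proof (rule card_inj_on_le[where f = "\<lambda>W. slice X x W \<zero>\<^bsub>R\<^esub>"])
      show "inj_on (\<lambda>W. slice X x W \<zero>\<^bsub>R\<^esub>) (?E r)"
      proof (rule inj_onI)
        fix W W' assume "W \<in> ?E r" "W' \<in> ?E r" "slice X x W \<zero>\<^bsub>R\<^esub> = slice X x W' \<zero>\<^bsub>R\<^esub>"
        then show "W = W'"
          using submodule_le_of_slices[OF R(1) insert.hyps(2), of W W']
            submodule_le_of_slices[OF R(1) insert.hyps(2), of W' W] by simp
      qed
      show "(\<lambda>W. slice X x W \<zero>\<^bsub>R\<^esub>) ` ?E r \<subseteq> ?D X r"
        using sl card_slice_empty[OF R(1) insert.hyps(2)] by auto
      show "finite (?D X r)" by (rule finX)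
    qed
    have split: "card (?D (insert x X) r) = card (?E r) + card (?N r)" for r
    proof -
      have "?D (insert x X) r = ?E r \<union> ?N r" by auto
      then have "card (?D (insert x X) r) = card (?E r \<union> ?N r)" by (rule arg_cong)
      also have "\<dots> = card (?E r) + card (?N r)"
      proof (rule card_Un_disjoint)
        show "finite (?E r)" "finite (?N r)" by (rule finite_subset[OF _ finI[of r]]; auto)+
      qed auto
      finally show ?thesis .
    qed
    show ?case
    proof (cases r)
      case 0
      have "?N 0 = {}"
      proof (rule equals0I)
        fix W assume "W \<in> ?N 0"
        then have W: "W \<in> fun_submodules R (insert x X)" "slice X x W \<one>\<^bsub>R\<^esub> \<noteq> {}" "card W = 1"
          by simp_all
        have "order R * card (slice X x W \<zero>\<^bsub>R\<^esub>) = 1"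
          using card_slice_nonempty[OF R(1) insert.hyps(2) W(1,2)] W(3) by simp
        with q show False by simp
      qed
      then have "real (card (?D (insert x X) 0)) \<le> real (card (?D X 0))"
        using E[of 0] split[of 0] by (simp only: card.empty)
      also have "\<dots> \<le> gauss_binomial (order R) (card X) 0" by (rule insert.IH)
      finally show ?thesis using 0 by (simp add: gauss_binomial_0)
    next
      case (Suc k)
      let ?C = "\<lambda>U. rcosets\<^bsub>add_monoid (product_ring X (\<lambda>_. R))\<^esub> U"
      have cosets: "card (?C U) = order R ^ (card X - k)" "finite (?C U)" if "U \<in> ?D X k" for U
      proof -
        from that have U: "U \<in> fun_submodules R X" "card U = order R ^ k" by auto
        have eq: "card (?C U) * order R ^ k = order R ^ card X"
          using card_cosets_fun_submodule[OF ringR R(2) insert.hyps(1) U(1)] U(2) by simp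
        obtain r where r: "r \<le> card X" "card U = order R ^ r"
          using card_fun_submodule[OF R insert.hyps(1) U(1)] by blast
        with U(2) q have "k \<le> card X" using power_inject_exp[of "order R" k r] by simp
        then have "order R ^ card X = order R ^ (card X - k) * order R ^ k"
          by (simp flip: power_add)
        with eq q show "card (?C U) = order R ^ (card X - k)" by simp
        with q show "finite (?C U)" by (metis card.infinite not_numeral_le_zero power_eq_0_iff)
      qed
      have "card (?N (Suc k)) \<le> card (SIGMA U:?D X k. ?C U)"
      proof (rule card_inj_on_le[where f = "\<lambda>W. (slice X x W \<zero>\<^bsub>R\<^esub>, slice X x W \<one>\<^bsub>R\<^esub>)"])
        show "inj_on (\<lambda>W. (slice X x W \<zero>\<^bsub>R\<^esub>, slice X x W \<one>\<^bsub>R\<^esub>)) (?N (Suc k))"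
          using slices_determine[OF R(1) insert.hyps(2)] by (intro inj_onI) auto
        show "(\<lambda>W. (slice X x W \<zero>\<^bsub>R\<^esub>, slice X x W \<one>\<^bsub>R\<^esub>)) ` ?N (Suc k) \<subseteq> (SIGMA U:?D X k. ?C U)"
        proof (rule image_subsetI)
          fix W assume "W \<in> ?N (Suc k)"
          then have W: "W \<in> fun_submodules R (insert x X)" "card W = order R ^ Suc k"
            "slice X x W \<one>\<^bsub>R\<^esub> \<noteq> {}" by simp_all
          have "card (slice X x W \<zero>\<^bsub>R\<^esub>) = order R ^ k"
            using card_slice_nonempty[OF R(1) insert.hyps(2) W(1,3)] W(2) q by simp
          then show "(slice X x W \<zero>\<^bsub>R\<^esub>, slice X x W \<one>\<^bsub>R\<^esub>) \<in> (SIGMA U:?D X k. ?C U)"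
            using sl[OF W(1)] slice_one_coset[OF R(1) insert.hyps(2) W(1,3)] by simp
        qed
        show "finite (SIGMA U:?D X k. ?C U)" using finX cosets(2) by (intro finite_SigmaI) auto
      qed
      also have "\<dots> = (\<Sum>U\<in>?D X k. card (?C U))"
        using finX cosets(2) by (intro card_SigmaI) auto
      also have "\<dots> = card (?D X k) * order R ^ (card X - k)" using cosets(1) by simp
      finally have N: "card (?N (Suc k)) \<le> card (?D X k) * order R ^ (card X - k)" .
      have "real (card (?D (insert x X) (Suc k)))
          \<le> real (card (?D X (Suc k))) + real (card (?D X k)) * real (order R) ^ (card X - k)"
      proof -
        have "card (?D (insert x X) (Suc k))
            \<le> card (?D X (Suc k)) + card (?D X k) * order R ^ (card X - k)"
          using split[of "Suc k"] E[of "Suc k"] N by linarith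
        then show ?thesis by (simp only: of_nat_le_iff flip: of_nat_add of_nat_mult of_nat_power)
      qed
      also have "\<dots> \<le> gauss_binomial (order R) (card X) (Suc k)
          + gauss_binomial (order R) (card X) k * real (order R) ^ (card X - k)"
        by (intro add_mono mult_right_mono insert.IH) simp
      also have "\<dots> = gauss_binomial (order R) (Suc (card X)) (Suc k)"
        using gauss_binomial_Pascal[OF q] by (simp add: mult.commute)
      finally show ?thesis using Suc insert.hyps by simp
    qed
  qed
qed

lemma card_fun_submodules:
  assumes R: "field R" "finite (carrier R)" and X: "finite X"
  shows "real (card (fun_submodules R X)) \<le> (\<Sum>r=0..card X. gauss_binomial (order R) (card X) r)"
proof -
  let ?D = "\<lambda>r. {W \<in> fun_submodules R X. card W = order R ^ r}"
  have "fun_submodules R X \<subseteq> (\<Union>r\<in>{0..card X}. ?D r)"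
    using card_fun_submodule[OF R X] by fastforce
  then have "card (fun_submodules R X) \<le> card (\<Union>r\<in>{0..card X}. ?D r)"
    using finite_fun_submodules[OF R(2) X] by (intro card_mono) auto
  also have "\<dots> \<le> (\<Sum>r=0..card X. card (?D r))" by (rule card_UN_le) simp
  finally have "real (card (fun_submodules R X)) \<le> real (\<Sum>r=0..card X. card (?D r))"
    by (simp only: of_nat_le_iff)
  also have "\<dots> \<le> (\<Sum>r=0..card X. gauss_binomial (order R) (card X) r)"
    unfolding of_nat_sum by (intro sum_mono card_fun_submodules_dim assms)
  finally show ?thesis .
qed

section \<open>Inversion by rank-one maps\<close>

(* Index sets are written {1..k}; the default rewriting of 1 to Suc 0 would hide them from the
   lemmas below. *)
declare One_nat_def [simp del]

definition vecs :: "('a, 'x) ring_scheme \<Rightarrow> nat \<Rightarrow> (nat \<Rightarrow> 'a) set" where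
  "vecs R k = {1..k} \<rightarrow>\<^sub>E carrier R"

definition zero_vec :: "('a, 'x) ring_scheme \<Rightarrow> nat \<Rightarrow> nat \<Rightarrow> 'a" where
  "zero_vec R k = (\<lambda>t\<in>{1..k}. \<zero>\<^bsub>R\<^esub>)"

definition dot :: "('a, 'x) ring_scheme \<Rightarrow> nat \<Rightarrow> (nat \<Rightarrow> 'a) \<Rightarrow> (nat \<Rightarrow> 'a) \<Rightarrow> 'a" where
  "dot R k a v = (\<Oplus>\<^bsub>R\<^esub>t\<in>{1..k}. a t \<otimes>\<^bsub>R\<^esub> v t)"

text \<open>
The linear map with matrix \<open>b a\<^sup>T\<close>, restricted to the vectors so that equal maps are equal as HOL
functions. This makes it harmless that \<open>(a, b)\<close> and \<open>(c a, c\<^sup>-\<^sup>1 b)\<close> describe the same map.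
\<close>

definition rank_one ::
    "('a, 'x) ring_scheme \<Rightarrow> nat \<Rightarrow> (nat \<Rightarrow> 'a) \<Rightarrow> (nat \<Rightarrow> 'a) \<Rightarrow> (nat \<Rightarrow> 'a) \<Rightarrow> nat \<Rightarrow> 'a" where
  "rank_one R k b a = (\<lambda>y\<in>vecs R k. \<lambda>r\<in>{1..k}. b r \<otimes>\<^bsub>R\<^esub> dot R k a y)"

text \<open>
The trace of \<open>b a\<^sup>T\<close> is \<open>dot a b\<close>. The map \<open>0\<close> arises here only from \<open>a = 0\<close>; in the inversion formula
it contributes nothing.
\<close>

definition rank_one_trace :: "('a, 'x) ring_scheme \<Rightarrow> nat \<Rightarrow> 'a \<Rightarrow> ((nat \<Rightarrow> 'a) \<Rightarrow> nat \<Rightarrow> 'a) set" where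
  "rank_one_trace R k \<tau> =
     {rank_one R k b a | a b. a \<in> vecs R k \<and> b \<in> vecs R k \<and> b \<noteq> zero_vec R k \<and> dot R k a b = \<tau>}"

lemma finite_vecs: "finite (carrier R) \<Longrightarrow> finite (vecs R k)"
  by (simp add: vecs_def finite_PiE)

lemma vecs_mem: "v \<in> vecs R k \<Longrightarrow> t \<in> {1..k} \<Longrightarrow> v t \<in> carrier R"
  unfolding vecs_def by (rule PiE_mem)

lemma vecs_eqI:
  assumes "v \<in> vecs R k" "w \<in> vecs R k" "\<And>t. t \<in> {1..k} \<Longrightarrow> v t = w t"
  shows "v = w"
  using assms unfolding vecs_def by (rule PiE_ext)

lemma vecs_restrictI: "(\<And>t. t \<in> {1..k} \<Longrightarrow> f t \<in> carrier R) \<Longrightarrow> restrict f {1..k} \<in> vecs R k"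
  unfolding vecs_def by (rule restrict_PiE_iff[THEN iffD2]) blast

context
  fixes R :: "('a, 'x) ring_scheme" (structure) and k :: nat
  assumes field: "field R"
begin

interpretation field R by (rule field)

lemma zero_vec_closed: "zero_vec R k \<in> vecs R k"
  unfolding zero_vec_def by (rule vecs_restrictI) simp

lemma dot_closed: "a \<in> vecs R k \<Longrightarrow> v \<in> vecs R k \<Longrightarrow> dot R k a v \<in> carrier R"
  unfolding dot_def by (intro finsum_closed Pi_I m_closed vecs_mem)

lemma dot_add:
  assumes "a \<in> vecs R k" "b \<in> vecs R k" "v \<in> vecs R k"
  shows "dot R k (\<lambda>t\<in>{1..k}. a t \<oplus> b t) v = dot R k a v \<oplus> dot R k b v"
proof -
  note m = vecs_mem[OF assms(1)] vecs_mem[OF assms(2)] vecs_mem[OF assms(3)]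
  have "dot R k (\<lambda>t\<in>{1..k}. a t \<oplus> b t) v = (\<Oplus>t\<in>{1..k}. a t \<otimes> v t \<oplus> b t \<otimes> v t)"
    unfolding dot_def using m by (intro finsum_cong') (auto simp: l_distr)
  also have "\<dots> = dot R k a v \<oplus> dot R k b v"
    unfolding dot_def using m by (intro finsum_addf) auto
  finally show ?thesis .
qed

lemma dot_smult:
  assumes "c \<in> carrier R" "a \<in> vecs R k" "v \<in> vecs R k"
  shows "dot R k (\<lambda>t\<in>{1..k}. c \<otimes> a t) v = c \<otimes> dot R k a v"
proof -
  note m = vecs_mem[OF assms(2)] vecs_mem[OF assms(3)]
  have "c \<otimes> dot R k a v = (\<Oplus>t\<in>{1..k}. c \<otimes> (a t \<otimes> v t))"
    unfolding dot_def using m assms(1) by (intro finsum_rdistr) auto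
  also have "\<dots> = dot R k (\<lambda>t\<in>{1..k}. c \<otimes> a t) v"
    unfolding dot_def using m assms(1) by (intro finsum_cong') (auto simp: m_assoc)
  finally show ?thesis by simp
qed

lemma dot_commute:
  assumes "a \<in> vecs R k" "v \<in> vecs R k"
  shows "dot R k a v = dot R k v a"
  unfolding dot_def using vecs_mem[OF assms(1)] vecs_mem[OF assms(2)]
  by (intro finsum_cong') (auto simp: m_comm)

lemma dot_zero:
  assumes "a \<in> vecs R k"
  shows "dot R k a (zero_vec R k) = \<zero>"
proof -
  have "dot R k a (zero_vec R k) = (\<Oplus>t\<in>{1..k}. \<zero>)"
    unfolding dot_def zero_vec_def using vecs_mem[OF assms] by (intro finsum_cong') auto
  then show ?thesis by (simp add: finsum_zero)
qed

text \<open>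
Coordinate functionals are dot products with unit vectors; this makes the pairing non-degenerate.
\<close>

lemma dot_detects:
  assumes i: "i \<in> {1..k}"
  shows "\<exists>e\<in>vecs R k. \<forall>w\<in>vecs R k. dot R k e w = w i"
proof (intro bexI ballI)
  let ?e = "\<lambda>t\<in>{1..k}. if t = i then \<one> else \<zero>"
  show "?e \<in> vecs R k" by (rule vecs_restrictI) simp
  fix w assume w: "w \<in> vecs R k"
  have "dot R k ?e w = (\<Oplus>t\<in>{1..k}. if i = t then w t else \<zero>)"
    unfolding dot_def using vecs_mem[OF w] by (intro finsum_cong') auto
  also have "\<dots> = w i" using vecs_mem[OF w] i by (intro finsum_singleton) auto
  finally show "dot R k ?e w = w i" .
qed

lemma dot_eqI:
  assumes v: "v \<in> vecs R k" and w: "w \<in> vecs R k"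
    and eq: "\<And>c. c \<in> vecs R k \<Longrightarrow> dot R k c v = dot R k c w"
  shows "v = w"
proof (rule vecs_eqI[OF v w])
  fix i assume "i \<in> {1..k}"
  then show "v i = w i" using dot_detects[of i] v w eq by metis
qed

lemma dot_one_exists:
  assumes v: "v \<in> vecs R k" and "v \<noteq> zero_vec R k"
  shows "\<exists>u\<in>vecs R k. dot R k u v = \<one>"
proof -
  have "\<not> (\<forall>c\<in>vecs R k. dot R k c v = dot R k c (zero_vec R k))"
    using dot_eqI[OF v zero_vec_closed] assms(2) by auto
  then obtain c where c: "c \<in> vecs R k" "dot R k c v \<noteq> \<zero>"
    using dot_zero by auto
  then have u: "dot R k c v \<in> Units R" using v by (simp add: field_Units dot_closed)
  then have "dot R k (\<lambda>t\<in>{1..k}. inv (dot R k c v) \<otimes> c t) v = \<one>"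
    using c v by (simp add: dot_smult)
  moreover have "(\<lambda>t\<in>{1..k}. inv (dot R k c v) \<otimes> c t) \<in> vecs R k"
    using u vecs_mem[OF c(1)] by (intro vecs_restrictI) auto
  ultimately show ?thesis by blast
qed

lemma card_translate:
  assumes u: "u \<in> vecs R k"
    and PQ: "\<And>a. a \<in> vecs R k \<Longrightarrow> P a \<longleftrightarrow> Q (\<lambda>t\<in>{1..k}. a t \<oplus> u t)"
  shows "card {a \<in> vecs R k. P a} = card {a \<in> vecs R k. Q a}"
proof (rule bij_betw_same_card)
  let ?f = "\<lambda>a. \<lambda>t\<in>{1..k}. a t \<oplus> u t" and ?g = "\<lambda>a. \<lambda>t\<in>{1..k}. a t \<ominus> u t"
  note um = vecs_mem[OF u]
  have f: "?f a \<in> vecs R k" and g: "?g a \<in> vecs R k"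
    and gf: "?g (?f a) = a" and fg: "?f (?g a) = a" if a: "a \<in> vecs R k" for a
  proof -
    note am = vecs_mem[OF a]
    show f: "?f a \<in> vecs R k" and g: "?g a \<in> vecs R k"
      using am um by (auto intro!: vecs_restrictI)
    have "?g (?f a) \<in> vecs R k" "?f (?g a) \<in> vecs R k"
      using am um by (auto intro!: vecs_restrictI)
    then show "?g (?f a) = a" "?f (?g a) = a"
      using am um a by (auto intro!: vecs_eqI[of _ R k] simp: a_minus_def a_assoc r_neg l_neg)
  qed
  show "bij_betw ?f {a \<in> vecs R k. P a} {a \<in> vecs R k. Q a}"
  proof (rule bij_betw_byWitness[where f' = ?g])
    show "\<forall>a\<in>{a \<in> vecs R k. P a}. ?g (?f a) = a" using gf by simp
    show "\<forall>a\<in>{a \<in> vecs R k. Q a}. ?f (?g a) = a" using fg by simp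
    show "?f ` {a \<in> vecs R k. P a} \<subseteq> {a \<in> vecs R k. Q a}" using f PQ by blast
    show "?g ` {a \<in> vecs R k. Q a} \<subseteq> {a \<in> vecs R k. P a}"
    proof
      fix b assume "b \<in> ?g ` {a \<in> vecs R k. Q a}"
      then obtain a where a: "a \<in> vecs R k" "Q a" and b: "b = ?g a" by blast
      have "Q (?f (?g a))" unfolding fg[OF a(1)] by (rule a(2))
      then have "P b" unfolding b by (subst PQ[OF g[OF a(1)]])
      then show "b \<in> {a \<in> vecs R k. P a}" using g[OF a(1)] b by blast
    qed
  qed
qed

text \<open>
The level sets of a non-zero functional on \<open>R\<^sup>k\<close> are translates of each other, so each contains
\<open>q\<^sup>k\<^sup>-\<^sup>1\<close> vectors.
\<close>

lemma card_dot_eq_one: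
  assumes fin: "finite (carrier R)" and v: "v \<in> vecs R k" and "v \<noteq> zero_vec R k"
  shows "card {a \<in> vecs R k. dot R k a v = \<one>} = order R ^ (k - 1)"
proof -
  let ?S = "\<lambda>c. {a \<in> vecs R k. dot R k a v = c}"
  obtain u where u: "u \<in> vecs R k" "dot R k u v = \<one>" using dot_one_exists assms by blast
  have eq: "card (?S c) = card (?S \<one>)" if c: "c \<in> carrier R" for c
  proof (rule card_translate[of "\<lambda>t\<in>{1..k}. (\<one> \<ominus> c) \<otimes> u t"])
    let ?u = "\<lambda>t\<in>{1..k}. (\<one> \<ominus> c) \<otimes> u t"
    show u': "?u \<in> vecs R k" using vecs_mem[OF u(1)] c by (intro vecs_restrictI) auto
    fix a assume a: "a \<in> vecs R k"
    have d: "dot R k a v \<in> carrier R" by (rule dot_closed[OF a v])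
    have "dot R k (\<lambda>t\<in>{1..k}. a t \<oplus> ?u t) v = dot R k a v \<oplus> (\<one> \<ominus> c)"
      using dot_add[OF a u' v] dot_smult[OF _ u(1) v, of "\<one> \<ominus> c"] u c by simp
    also have "\<dots> = \<one> \<longleftrightarrow> dot R k a v = c"
    proof
      assume "dot R k a v \<oplus> (\<one> \<ominus> c) = \<one>"
      moreover have "c \<oplus> (\<one> \<ominus> c) = \<one>" using c by (simp add: a_minus_def a_lcomm[of c] r_neg)
      ultimately show "dot R k a v = c" using c d by (metis add.right_cancel minus_closed one_closed)
    next
      assume "dot R k a v = c"
      then show "dot R k a v \<oplus> (\<one> \<ominus> c) = \<one>" using c by (simp add: a_minus_def a_lcomm[of c] r_neg)
    qed
    finally show "dot R k a v = c \<longleftrightarrow> dot R k (\<lambda>t\<in>{1..k}. a t \<oplus> ?u t) v = \<one>" by simp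
  qed
  have "vecs R k = (\<Union>c\<in>carrier R. ?S c)" using dot_closed v by auto
  then have "card (vecs R k) = card (\<Union>c\<in>carrier R. ?S c)" by (rule arg_cong)
  also have "\<dots> = (\<Sum>c\<in>carrier R. card (?S c))"
    using fin finite_vecs[OF fin] by (intro card_UN_disjoint) auto
  also have "\<dots> = (\<Sum>c\<in>carrier R. card (?S \<one>))" by (intro sum.cong refl eq)
  also have "\<dots> = order R * card (?S \<one>)" by (simp add: order_def)
  also have "card (vecs R k) = order R ^ k" by (simp add: vecs_def card_PiE order_def)
  finally have *: "order R ^ k = order R * card (?S \<one>)" .
  have "k \<noteq> 0"
  proof
    assume "k = 0"
    \<comment> \<open>There is no non-zero vector of length \<open>0\<close>.\<close>
    then have "v = zero_vec R k" using vecs_eqI[OF v zero_vec_closed] by simp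
    then show False using assms by simp
  qed
  then have "order R * order R ^ (k - 1) = order R * card (?S \<one>)"
    using * by (simp flip: power_Suc)
  moreover have "order R \<noteq> 0" using fin by (auto simp: order_def)
  ultimately show ?thesis by simp
qed

text \<open>
If \<open>v\<close> and \<open>w\<close> are linearly independent, some \<open>c\<close> is orthogonal to \<open>v\<close> but not to \<open>w\<close>, and translation
by a multiple of it matches the two sets. If \<open>w\<close> is a multiple of \<open>v\<close>, the value of \<open>dot a w\<close> is fixed
by \<open>dot a v = 1\<close>: it is \<open>1\<close> for \<open>w = v\<close>, and neither \<open>0\<close> nor \<open>1\<close> for any other \<open>w \<noteq> 0\<close>. The counts
agree trivially when \<open>v = 0\<close>.
\<close>

lemma card_dot_pair:
  assumes fin: "finite (carrier R)" and v: "v \<in> vecs R k" and w: "w \<in> vecs R k" "w \<noteq> zero_vec R k"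
  shows "card {a \<in> vecs R k. dot R k a v = \<one> \<and> dot R k a w = \<one>}
    = card {a \<in> vecs R k. dot R k a v = \<one> \<and> dot R k a w = \<zero>}
      + (if v = w then order R ^ (k - 1) else 0)"
proof (cases "v = w")
  case True
  have "{a \<in> vecs R k. dot R k a v = \<one> \<and> dot R k a w = \<zero>} = {}" using True by auto
  then show ?thesis using True card_dot_eq_one[OF fin w] by (simp only: card.empty) simp
next
  case vw: False
  show ?thesis
  proof (cases "\<exists>c\<in>vecs R k. dot R k c v = \<zero> \<and> dot R k c w \<noteq> \<zero>")
    case True
    then obtain c where c: "c \<in> vecs R k" "dot R k c v = \<zero>" "dot R k c w \<noteq> \<zero>" by blast
    define u where "u = (\<lambda>t\<in>{1..k}. inv (dot R k c w) \<otimes> c t)"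
    have unit: "dot R k c w \<in> Units R" using c w by (simp add: field_Units dot_closed)
    have u: "u \<in> vecs R k" unfolding u_def using unit vecs_mem[OF c(1)] by (intro vecs_restrictI) auto
    have uv: "dot R k u v = \<zero>" and uw: "dot R k u w = \<one>"
      unfolding u_def using unit c v w by (simp_all add: dot_smult)
    have "card {a \<in> vecs R k. dot R k a v = \<one> \<and> dot R k a w = \<zero>}
        = card {a \<in> vecs R k. dot R k a v = \<one> \<and> dot R k a w = \<one>}"
    proof (rule card_translate[OF u])
      fix a assume a: "a \<in> vecs R k"
      have d: "dot R k a v \<in> carrier R" "dot R k a w \<in> carrier R" by (rule dot_closed[OF a v] dot_closed[OF a w(1)])+
      show "dot R k a v = \<one> \<and> dot R k a w = \<zero> \<longleftrightarrow>
          dot R k (\<lambda>t\<in>{1..k}. a t \<oplus> u t) v = \<one> \<and> dot R k (\<lambda>t\<in>{1..k}. a t \<oplus> u t) w = \<one>"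
        unfolding dot_add[OF a u v] dot_add[OF a u w(1)] uv uw using d
        by (simp add: add.r_cancel_one)
    qed
    with vw show ?thesis by simp
  next
    case False
    \<comment> \<open>Every functional that kills \<open>v\<close> kills \<open>w\<close>. Subtracting from \<open>c\<close> a multiple of \<open>a\<close> gives such a functional.\<close>
    have rel: "dot R k c w = dot R k c v \<otimes> dot R k a w"
      if a: "a \<in> vecs R k" "dot R k a v = \<one>" and c: "c \<in> vecs R k" for a c
    proof -
      let ?n = "\<ominus> dot R k c v"
      define b where "b = (\<lambda>t\<in>{1..k}. ?n \<otimes> a t)"
      define d where "d = (\<lambda>t\<in>{1..k}. c t \<oplus> b t)"
      have n: "dot R k c v \<in> carrier R" by (rule dot_closed[OF c v])
      have aw: "dot R k a w \<in> carrier R" "dot R k c w \<in> carrier R"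
        by (rule dot_closed[OF a(1) w(1)] dot_closed[OF c w(1)])+
      have b: "b \<in> vecs R k" unfolding b_def using n vecs_mem[OF a(1)] by (intro vecs_restrictI) auto
      have d: "d \<in> vecs R k" unfolding d_def
        using vecs_mem[OF c] vecs_mem[OF b] by (intro vecs_restrictI) auto
      have dy: "dot R k d y = dot R k c y \<oplus> \<ominus> (dot R k c v \<otimes> dot R k a y)"
        if y: "y \<in> vecs R k" for y
        using dot_add[OF c b y] dot_smult[OF a_inv_closed[OF n] a(1) y] n dot_closed[OF a(1) y]
        unfolding d_def[symmetric] b_def[symmetric] by (simp add: l_minus)
      have "dot R k d v = \<zero>" unfolding dy[OF v] a(2) using n by (simp add: r_neg)
      then have "dot R k d w = \<zero>" using False d by blast
      then have "dot R k c w \<oplus> \<ominus> (dot R k c v \<otimes> dot R k a w) = \<zero>"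
        unfolding dy[OF w(1)] .
      then show ?thesis using n aw by (metis minus_equality minus_minus m_closed a_inv_closed)
    qed
    have "False" if a: "a \<in> vecs R k" "dot R k a v = \<one>" and "dot R k a w = \<one>" for a
    proof -
      have "v = w" using rel[OF a] that dot_closed[OF _ v] by (intro dot_eqI[OF v w(1)]) simp
      with vw show False by simp
    qed
    moreover have "False" if a: "a \<in> vecs R k" "dot R k a v = \<one>" and "dot R k a w = \<zero>" for a
    proof -
      have "w = zero_vec R k"
        using rel[OF a] that dot_closed[OF _ v] by (intro dot_eqI[OF w(1) zero_vec_closed]) (simp add: dot_zero)
      with w show False by simp
    qed
    ultimately have "{a \<in> vecs R k. dot R k a v = \<one> \<and> dot R k a w = \<one>} = {}"
      "{a \<in> vecs R k. dot R k a v = \<one> \<and> dot R k a w = \<zero>} = {}" by blast+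
    with vw show ?thesis by (simp only: card.empty) simp
  qed
qed

lemma rank_one_apply: "y \<in> vecs R k \<Longrightarrow> r \<in> {1..k} \<Longrightarrow> rank_one R k b a y r = b r \<otimes> dot R k a y"
  by (simp add: rank_one_def)

lemma rank_one_closed:
  assumes "a \<in> vecs R k" "b \<in> vecs R k" "y \<in> vecs R k"
  shows "rank_one R k b a y \<in> vecs R k"
  unfolding rank_one_def using assms vecs_mem[OF assms(2)] dot_closed[OF assms(1,3)]
  by (auto intro!: vecs_restrictI)

text \<open>
A rank-one map sending \<open>v\<close> to \<open>w \<noteq> 0\<close> has image spanned by \<open>w\<close>, so it can be written uniquely as
\<open>w a\<^sup>T\<close>; then \<open>dot a v = 1\<close>, and its trace is \<open>dot a w\<close>.
\<close>

lemma card_rank_one_fibre: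
  assumes v: "v \<in> vecs R k" and w: "w \<in> vecs R k" "w \<noteq> zero_vec R k"
  shows "card {L \<in> rank_one_trace R k \<tau>. L v = w}
    = card {a \<in> vecs R k. dot R k a v = \<one> \<and> dot R k a w = \<tau>}"
proof -
  note wm = vecs_mem[OF w(1)]
  have "inj_on (rank_one R k w) (vecs R k)"
  proof (rule inj_onI)
    fix a a' assume a: "a \<in> vecs R k" and a': "a' \<in> vecs R k" and eq: "rank_one R k w a = rank_one R k w a'"
    obtain i where i: "i \<in> {1..k}" "w i \<noteq> \<zero>"
    proof -
      have "\<exists>i\<in>{1..k}. w i \<noteq> zero_vec R k i" using vecs_eqI[OF w(1) zero_vec_closed] w(2) by blast
      then show ?thesis using that by (auto simp: zero_vec_def)
    qed
    show "a = a'"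
    proof (rule dot_eqI[OF a a'])
      fix c assume c: "c \<in> vecs R k"
      have "w i \<otimes> dot R k a c = w i \<otimes> dot R k a' c"
        using fun_cong[OF fun_cong[OF eq, of c], of i] c i by (simp add: rank_one_apply)
      then have "dot R k a c = dot R k a' c"
        using i wm[OF i(1)] dot_closed[OF a c] dot_closed[OF a' c] by (simp add: m_lcancel)
      then show "dot R k c a = dot R k c a'" using dot_commute a a' c by simp
    qed
  qed
  moreover have "rank_one R k w ` {a \<in> vecs R k. dot R k a v = \<one> \<and> dot R k a w = \<tau>}
      = {L \<in> rank_one_trace R k \<tau>. L v = w}" (is "?l = ?r")
  proof (intro Set.set_eqI iffI)
    fix L assume "L \<in> ?l"
    then obtain a where a: "a \<in> vecs R k" "dot R k a v = \<one>" "dot R k a w = \<tau>"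
      and L: "L = rank_one R k w a" by blast
    have "L v = w" unfolding L
      using wm a by (intro vecs_eqI[OF rank_one_closed[OF a(1) w(1) v] w(1)]) (simp add: rank_one_apply v)
    then show "L \<in> ?r" using a w L by (auto simp: rank_one_trace_def)
  next
    fix L assume "L \<in> ?r"
    then obtain a b where ab: "a \<in> vecs R k" "b \<in> vecs R k" "dot R k a b = \<tau>"
      and L: "L = rank_one R k b a" and Lv: "L v = w"
      by (auto simp: rank_one_trace_def)
    note am = vecs_mem[OF ab(1)] and bm = vecs_mem[OF ab(2)]
    define c where "c = dot R k a v"
    have c: "c \<in> carrier R" unfolding c_def by (rule dot_closed[OF ab(1) v])
    have wb: "w t = b t \<otimes> c" if "t \<in> {1..k}" for t
      using that Lv v unfolding L c_def by (metis rank_one_apply)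
    have "c \<noteq> \<zero>"
    proof
      assume "c = \<zero>"
      then have "w = zero_vec R k" using wb bm
        by (intro vecs_eqI[OF w(1) zero_vec_closed]) (simp add: zero_vec_def)
      with w show False by simp
    qed
    then have u: "c \<in> Units R" using c by (simp add: field_Units)
    define a' where "a' = (\<lambda>t\<in>{1..k}. inv c \<otimes> a t)"
    have a': "a' \<in> vecs R k" unfolding a'_def using u am by (intro vecs_restrictI) auto
    have sm: "dot R k a' y = inv c \<otimes> dot R k a y" if "y \<in> vecs R k" for y
      unfolding a'_def using u ab(1) that by (simp add: dot_smult)
    have "w = (\<lambda>t\<in>{1..k}. c \<otimes> b t)"
      using wb bm c by (intro vecs_eqI[OF w(1)] vecs_restrictI) (auto simp: m_comm)
    then have "dot R k a w = c \<otimes> dot R k a b"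
      using dot_smult[OF c ab(2,1)] dot_commute[OF ab(1,2)] dot_commute[OF ab(1) w(1)] by simp
    then have "dot R k a' w = \<tau>" using sm[OF w(1)] u c ab(3) dot_closed[OF ab(1,2)]
      by (simp flip: m_assoc)
    moreover have "dot R k a' v = \<one>" using sm[OF v] u by (simp flip: c_def)
    moreover have "L = rank_one R k w a'"
    proof -
      have "rank_one R k b a y = rank_one R k w a' y" if y: "y \<in> vecs R k" for y
      proof (rule vecs_eqI[OF rank_one_closed[OF ab(1,2) y] rank_one_closed[OF a' w(1) y]])
        fix t assume t: "t \<in> {1..k}"
        have "b t \<otimes> dot R k a y = (b t \<otimes> c) \<otimes> (inv c \<otimes> dot R k a y)"
          using u c bm[OF t] dot_closed[OF ab(1) y] Units_r_inv[OF u] Units_inv_closed[OF u]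
          by (metis l_one m_assoc m_closed)
        then show "rank_one R k b a y t = rank_one R k w a' y t"
          using t y wb[OF t] sm[OF y] by (simp add: rank_one_apply)
      qed
      then show ?thesis unfolding L by (auto simp: rank_one_def fun_eq_iff restrict_def)
    qed
    ultimately show "L \<in> ?l" using a' by blast
  qed
  ultimately show ?thesis
    by (metis (no_types, lifting) card_image inj_on_subset mem_Collect_eq subsetI)
qed

lemma finite_rank_one_trace:
  assumes "finite (carrier R)"
  shows "finite (rank_one_trace R k \<tau>)"
proof -
  have "rank_one_trace R k \<tau> \<subseteq> (\<lambda>(a, b). rank_one R k b a) ` (vecs R k \<times> vecs R k)"
    by (auto simp: rank_one_trace_def)
  then show ?thesis using finite_vecs[OF assms] finite_subset by blast
qed

end

lemma (in abelian_group) finsum_fibres: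
  assumes "finite T" "finite V" "\<And>L. L \<in> T \<Longrightarrow> \<phi> L \<in> V" and h: "\<And>w. w \<in> V \<Longrightarrow> h w \<in> carrier G"
  shows "(\<Oplus>L\<in>T. h (\<phi> L)) = (\<Oplus>w\<in>V. [card {L \<in> T. \<phi> L = w}] \<cdot> h w)"
proof -
  have "T = (\<Union>w\<in>V. {L \<in> T. \<phi> L = w})" using assms(3) by auto
  then have "(\<Oplus>L\<in>T. h (\<phi> L)) = (\<Oplus>L\<in>(\<Union>w\<in>V. {L \<in> T. \<phi> L = w}). h (\<phi> L))"
    by (rule arg_cong[where f = "\<lambda>T. \<Oplus>L\<in>T. h (\<phi> L)"])
  also have "\<dots> = (\<Oplus>w\<in>V. \<Oplus>L\<in>{L \<in> T. \<phi> L = w}. h (\<phi> L))"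
    using assms by (intro add.finprod_UN_disjoint) (auto simp: pairwise_def disjnt_def)
  also have "\<dots> = (\<Oplus>w\<in>V. [card {L \<in> T. \<phi> L = w}] \<cdot> h w)"
  proof (intro finsum_cong' refl Pi_I)
    fix w assume w: "w \<in> V"
    have "(\<Oplus>L\<in>{L \<in> T. \<phi> L = w}. h (\<phi> L)) = (\<Oplus>L\<in>{L \<in> T. \<phi> L = w}. h w)"
      using h[OF w] by (intro finsum_cong') auto
    also have "\<dots> = [card {L \<in> T. \<phi> L = w}] \<cdot> h w" using h[OF w] by (rule add.finprod_const)
    finally show "(\<Oplus>L\<in>{L \<in> T. \<phi> L = w}. h (\<phi> L)) = [card {L \<in> T. \<phi> L = w}] \<cdot> h w" .
  qed (use h in auto)
  finally show ?thesis .
qed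

text \<open>
The key identity. Grouping the maps \<open>L\<close> by \<open>w = L v\<close>, the difference of the coefficients of \<open>g w\<close> is
given by \<open>card_dot_pair\<close>: it is \<open>q\<^sup>k\<^sup>-\<^sup>1\<close> for \<open>w = v\<close> and \<open>0\<close> for every other non-zero \<open>w\<close>. The vector
\<open>w = 0\<close> is taken care of by \<open>g 0 = 0\<close>. So, up to the factor \<open>q\<^sup>k\<^sup>-\<^sup>1\<close>, the value of \<open>g\<close> at \<open>v\<close> is a
combination of values of \<open>g\<close> at images of \<open>v\<close> under rank-one maps that do not depend on \<open>v\<close>.
\<close>

lemma rank_one_inversion:
  fixes R :: "('a, 'x) ring_scheme" and G :: "('b, 'y) ring_scheme"
  assumes R: "field R" "finite (carrier R)" and G: "abelian_group G"
    and g: "\<And>w. w \<in> vecs R k \<Longrightarrow> g w \<in> carrier G" "g (zero_vec R k) = \<zero>\<^bsub>G\<^esub>" and v: "v \<in> vecs R k"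
  shows "(\<Oplus>\<^bsub>G\<^esub>L\<in>rank_one_trace R k \<one>\<^bsub>R\<^esub>. g (L v))
    = (\<Oplus>\<^bsub>G\<^esub>L\<in>rank_one_trace R k \<zero>\<^bsub>R\<^esub>. g (L v)) \<oplus>\<^bsub>G\<^esub> [(order R ^ (k - 1))] \<cdot>\<^bsub>G\<^esub> g v"
proof -
  interpret G: abelian_group G by (rule G)
  let ?T = "rank_one_trace R k" and ?V = "vecs R k"
  let ?n = "\<lambda>\<tau> w. card {L \<in> ?T \<tau>. L v = w}"
  have fin: "finite ?V" by (rule finite_vecs[OF R(2)])
  have Lv: "L v \<in> ?V" if "L \<in> ?T \<tau>" for L \<tau>
    using that rank_one_closed[OF R(1) _ _ v] by (auto simp: rank_one_trace_def)
  have sum: "(\<Oplus>\<^bsub>G\<^esub>L\<in>?T \<tau>. g (L v)) = (\<Oplus>\<^bsub>G\<^esub>w\<in>?V. [?n \<tau> w] \<cdot>\<^bsub>G\<^esub> g w)" for \<tau>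
    by (rule G.finsum_fibres[OF finite_rank_one_trace[OF R] fin Lv g(1)])
  have step: "[?n \<one>\<^bsub>R\<^esub> w] \<cdot>\<^bsub>G\<^esub> g w
      = [?n \<zero>\<^bsub>R\<^esub> w] \<cdot>\<^bsub>G\<^esub> g w \<oplus>\<^bsub>G\<^esub> (if v = w then [(order R ^ (k - 1))] \<cdot>\<^bsub>G\<^esub> g w else \<zero>\<^bsub>G\<^esub>)"
    if w: "w \<in> ?V" for w
  proof (cases "w = zero_vec R k")
    case True
    then show ?thesis using g(2) by simp
  next
    case False
    have "?n \<one>\<^bsub>R\<^esub> w = ?n \<zero>\<^bsub>R\<^esub> w + (if v = w then order R ^ (k - 1) else 0)"
      unfolding card_rank_one_fibre[OF R(1) v w False] by (rule card_dot_pair[OF R v w False])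
    then show ?thesis using g(1)[OF w] by (auto simp: G.add.nat_pow_mult)
  qed
  have "(\<Oplus>\<^bsub>G\<^esub>L\<in>?T \<one>\<^bsub>R\<^esub>. g (L v)) = (\<Oplus>\<^bsub>G\<^esub>w\<in>?V. [?n \<zero>\<^bsub>R\<^esub> w] \<cdot>\<^bsub>G\<^esub> g w
      \<oplus>\<^bsub>G\<^esub> (if v = w then [(order R ^ (k - 1))] \<cdot>\<^bsub>G\<^esub> g w else \<zero>\<^bsub>G\<^esub>))"
    unfolding sum using g(1) by (intro G.finsum_cong' refl Pi_I step) auto
  also have "\<dots> = (\<Oplus>\<^bsub>G\<^esub>w\<in>?V. [?n \<zero>\<^bsub>R\<^esub> w] \<cdot>\<^bsub>G\<^esub> g w)
      \<oplus>\<^bsub>G\<^esub> (\<Oplus>\<^bsub>G\<^esub>w\<in>?V. if v = w then [(order R ^ (k - 1))] \<cdot>\<^bsub>G\<^esub> g w else \<zero>\<^bsub>G\<^esub>)"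
    using g(1) by (intro G.finsum_addf Pi_I) auto
  also have "(\<Oplus>\<^bsub>G\<^esub>w\<in>?V. if v = w then [(order R ^ (k - 1))] \<cdot>\<^bsub>G\<^esub> g w else \<zero>\<^bsub>G\<^esub>)
      = [(order R ^ (k - 1))] \<cdot>\<^bsub>G\<^esub> g v"
    using g(1) fin v by (intro G.finsum_singleton) auto
  finally show ?thesis unfolding sum .
qed

section \<open>Reduction to unary functions\<close>

lemma fun_submodules_finsum:
  assumes F: "ring F" and S: "S \<in> fun_submodules F X" and "finite T" and \<phi>: "\<And>L. L \<in> T \<Longrightarrow> \<phi> L \<in> S"
  shows "(\<lambda>x\<in>X. \<Oplus>\<^bsub>F\<^esub>L\<in>T. \<phi> L x) \<in> S"
  using \<open>finite T\<close> \<phi>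
proof (induction T rule: finite_induct)
  case empty
  interpret ring F by (rule F)
  show ?case by (simp only: finsum_empty fun_submodules_zero[OF F S])
next
  case (insert L T)
  interpret ring F by (rule F)
  have L: "\<phi> L \<in> S" and IH: "(\<lambda>x\<in>X. \<Oplus>\<^bsub>F\<^esub>L\<in>T. \<phi> L x) \<in> S" using insert by blast+
  show ?case
  proof (rule fun_submodules_add[OF F S L IH])
    fix x assume x: "x \<in> X"
    have "\<phi> M x \<in> carrier F" if "M \<in> insert L T" for M
      using fun_submodules_mem[OF S _ x] insert.prems[OF that] by blast
    then show "(\<lambda>x\<in>X. \<Oplus>\<^bsub>F\<^esub>L\<in>insert L T. \<phi> L x) x = \<phi> L x \<oplus>\<^bsub>F\<^esub> (\<lambda>x\<in>X. \<Oplus>\<^bsub>F\<^esub>L\<in>T. \<phi> L x) x"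
      using x insert.hyps by (simp add: Pi_def)
  qed (rule restrict_extensional)
qed

text \<open>
By Bezout, \<open>N x\<close> is congruent to \<open>1\<close> modulo the order of the ring for some \<open>x\<close>, and the order
annihilates the additive group; so \<open>d = [x] \<cdot> \<one>\<close> is inverse to \<open>[N] \<cdot> \<one>\<close>.
\<close>

lemma (in ring) coprime_order_unit:
  assumes fin: "finite (carrier R)" and N: "coprime N (order R)" "N \<noteq> 0"
  shows "\<exists>d\<in>carrier R. \<forall>y\<in>carrier R. d \<otimes> ([N] \<cdot> y) = y"
proof -
  obtain x y where xy: "N * x = order R * y + 1"
    using bezout_nat[OF N(2), of "order R"] N(1) by (auto simp: coprime_iff_gcd_eq_1)
  have z: "[order R] \<cdot> a = \<zero>" if "a \<in> carrier R" for a
    using group.pow_order_eq_1[OF a_group, of a] that by (simp add: order_def add_pow_def)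
  have "([x] \<cdot> \<one>) \<otimes> ([N] \<cdot> a) = a" if a: "a \<in> carrier R" for a
  proof -
    have "([x] \<cdot> \<one>) \<otimes> ([N] \<cdot> a) = [(N * x)] \<cdot> a"
      using a by (simp add: add_pow_ldistr add.nat_pow_pow)
    also have "\<dots> = [(order R * y)] \<cdot> a \<oplus> [(1::nat)] \<cdot> a"
      unfolding xy by (rule add.nat_pow_mult[OF a, symmetric])
    also have "[(order R * y)] \<cdot> a = [y] \<cdot> ([order R] \<cdot> a)"
      using a by (simp add: add.nat_pow_pow)
    finally show ?thesis using a z[OF a] by simp
  qed
  then show ?thesis by (intro bexI[of _ "[x] \<cdot> \<one>"]) auto
qed

lemma arg_space_coord: "x \<in> arg_space m K k \<Longrightarrow> j \<in> {1..m} \<Longrightarrow> x j \<in> vecs (K j) k"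
  unfolding arg_space_def vecs_def by (rule PiE_mem)

lemma arg_space_restrictI:
  "(\<And>j. j \<in> {1..m} \<Longrightarrow> h j \<in> vecs (K j) k) \<Longrightarrow> restrict h {1..m} \<in> arg_space m K k"
  unfolding arg_space_def vecs_def by (rule restrict_PiE_iff[THEN iffD2]) blast

lemma arg_space_ext: "x \<in> arg_space m K k \<Longrightarrow> restrict x {1..m} = x"
  unfolding arg_space_def by (rule PiE_restrict)

lemma arg_space_upd:
  assumes "x \<in> arg_space m K k" "j \<in> {1..m}" "v \<in> vecs (K j) k"
  shows "x(j := v) \<in> arg_space m K k"
  using PiE_fun_upd[of v "\<lambda>j. {1..k} \<rightarrow>\<^sub>E carrier (K j)" j x "{1..m}"] assms
  by (simp add: arg_space_def vecs_def insert_absorb)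

text \<open>
The inversion formula, applied in the \<open>j\<close>-th argument with all others held fixed: since the maps
\<open>L\<close> do not depend on the point, the formula expresses \<open>f\<close> as a linear combination of functions
obtained from \<open>f\<close> by substituting rank-one maps. Coprimality serves to divide by \<open>q\<^sup>k\<^sup>-\<^sup>1\<close>.
\<close>

lemma rank_one_coordinate_reduction:
  assumes F: "ring F" "finite (carrier F)" and K: "field (K j)" "finite (carrier (K j))"
    and cop: "coprime (order (K j)) (order F)" and j: "j \<in> {1..m}"
    and S: "S \<in> fun_submodules F (arg_space m K k)" and f: "f \<in> kary_functions F m K k"
    and H: "\<And>a b. a \<in> vecs (K j) k \<Longrightarrow> b \<in> vecs (K j) k \<Longrightarrow>
      (\<lambda>x\<in>arg_space m K k. f (x(j := rank_one (K j) k b a (x j)))) \<in> S"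
  shows "f \<in> S"
proof -
  interpret F: ring F by (rule F)
  let ?X = "arg_space m K k" and ?T = "rank_one_trace (K j) k" and ?z = "zero_vec (K j) k"
  let ?N = "order (K j) ^ (k - 1)"
  have z: "?z \<in> vecs (K j) k" by (rule zero_vec_closed[OF K(1)])
  have fx: "f x \<in> carrier F" if "x \<in> ?X" for x
    using f that unfolding kary_functions_def by (rule PiE_mem)
  have upd: "x(j := v) \<in> ?X" if "x \<in> ?X" "v \<in> vecs (K j) k" for x v
    using arg_space_upd[OF that(1) j that(2)] .
  have rz: "rank_one (K j) k ?z ?z y = ?z" if y: "y \<in> vecs (K j) k" for y
  proof -
    interpret Kj: field "K j" by (rule K)
    show ?thesis
      using dot_closed[OF K(1) z y]
      by (intro vecs_eqI[OF rank_one_closed[OF K(1) z z y] z])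
        (simp add: rank_one_apply[OF K(1) y], simp add: zero_vec_def)
  qed
  \<comment> \<open>The formula needs a function that vanishes when the \<open>j\<close>-th argument is \<open>0\<close>, hence \<open>f\<close> is replaced by \<open>f - Z\<close>. The zero map is \<open>0 0\<^sup>T\<close>, so \<open>Z\<close> lies in \<open>S\<close> too.\<close>
  define Z where "Z = (\<lambda>x\<in>?X. f (x(j := ?z)))"
  have "(\<lambda>x\<in>?X. f (x(j := rank_one (K j) k ?z ?z (x j)))) = Z"
    unfolding Z_def by (rule restrict_ext) (simp only: rz arg_space_coord[OF _ j])
  then have Z: "Z \<in> S" using H[OF z z] by simp
  define f' where "f' = (\<lambda>x\<in>?X. f x \<ominus>\<^bsub>F\<^esub> Z x)"
  have f'x: "f' x \<in> carrier F" if "x \<in> ?X" for x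
    using fx[OF that] fun_submodules_mem[OF S Z that] that by (simp add: f'_def)
  have LX: "L y \<in> vecs (K j) k" if "L \<in> ?T \<tau>" "y \<in> vecs (K j) k" for L \<tau> y
    using that rank_one_closed[OF K(1)] by (auto simp: rank_one_trace_def)
  have act: "(\<lambda>x\<in>?X. f' (x(j := L (x j)))) \<in> S" if L: "L \<in> ?T \<tau>" for L \<tau>
  proof -
    obtain a b where ab: "a \<in> vecs (K j) k" "b \<in> vecs (K j) k" and Lab: "L = rank_one (K j) k b a"
      using L by (auto simp: rank_one_trace_def)
    show ?thesis
    proof (rule fun_submodules_diff[OF F(1) S H[OF ab] Z])
      fix x assume x: "x \<in> ?X"
      have "x(j := L (x j)) \<in> ?X" using upd[OF x LX[OF L arg_space_coord[OF x j]]] .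
      then show "(\<lambda>x\<in>?X. f' (x(j := L (x j)))) x
          = (\<lambda>x\<in>?X. f (x(j := rank_one (K j) k b a (x j)))) x \<ominus>\<^bsub>F\<^esub> Z x"
        using x by (simp add: f'_def Z_def Lab)
    qed simp
  qed
  \<comment> \<open>The two sides of the inversion formula as functions of the point.\<close>
  define s where "s \<tau> = (\<lambda>x\<in>?X. \<Oplus>\<^bsub>F\<^esub>L\<in>?T \<tau>. (\<lambda>x\<in>?X. f' (x(j := L (x j)))) x)" for \<tau>
  have s: "s \<tau> \<in> S" for \<tau>
    unfolding s_def
    by (rule fun_submodules_finsum[OF F(1) S finite_rank_one_trace[OF K] act])
  define h where "h = (\<lambda>x\<in>?X. [?N] \<cdot>\<^bsub>F\<^esub> f' x)"
  have hS: "h \<in> S"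
  proof (rule fun_submodules_diff[OF F(1) S s s])
    fix x assume x: "x \<in> ?X"
    let ?g = "\<lambda>v. f' (x(j := v))"
    have xj: "x j \<in> vecs (K j) k" by (rule arg_space_coord[OF x j])
    have g: "?g w \<in> carrier F" if "w \<in> vecs (K j) k" for w by (rule f'x[OF upd[OF x that]])
    have g0: "?g ?z = \<zero>\<^bsub>F\<^esub>"
      using upd[OF x z] fx[OF upd[OF x z]] by (simp add: f'_def Z_def a_minus_def F.r_neg)
    have sx: "s \<tau> x = (\<Oplus>\<^bsub>F\<^esub>L\<in>?T \<tau>. ?g (L (x j)))" for \<tau> using x by (simp add: s_def)
    have "s \<one>\<^bsub>K j\<^esub> x = s \<zero>\<^bsub>K j\<^esub> x \<oplus>\<^bsub>F\<^esub> [?N] \<cdot>\<^bsub>F\<^esub> f' x"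
      unfolding sx using rank_one_inversion[where g = "\<lambda>v. f' (x(j := v))", OF K F.abelian_group_axioms g g0 xj] by simp
    moreover have "s \<zero>\<^bsub>K j\<^esub> x \<in> carrier F" by (rule fun_submodules_mem[OF S s x])
    moreover have "[?N] \<cdot>\<^bsub>F\<^esub> f' x \<in> carrier F" using f'x[OF x] by simp
    ultimately show "h x = s \<one>\<^bsub>K j\<^esub> x \<ominus>\<^bsub>F\<^esub> s \<zero>\<^bsub>K j\<^esub> x"
      using x by (simp add: h_def a_minus_def F.a_ac F.r_neg F.l_neg F.r_neg1 F.r_neg2)
  qed (simp add: h_def)
  have "order (K j) \<noteq> 0"
  proof -
    interpret Kj: field "K j" by (rule K)
    show ?thesis using K(2) by (auto simp: order_def)
  qed
  then obtain d where d: "d \<in> carrier F" "\<And>y. y \<in> carrier F \<Longrightarrow> d \<otimes>\<^bsub>F\<^esub> ([?N] \<cdot>\<^bsub>F\<^esub> y) = y"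
    using F.coprime_order_unit[OF F(2), of ?N] cop by auto
  have f'S: "f' \<in> S"
    using f'x by (intro fun_submodules_comb[OF S d(1) F.zero_closed hS hS])
      (auto simp: f'_def[THEN fun_cong] h_def d(2) f'_def)
  show ?thesis
  proof (rule fun_submodules_add[OF F(1) S f'S Z])
    show "f \<in> extensional ?X" using f by (simp add: kary_functions_def PiE_def)
    show "f x = f' x \<oplus>\<^bsub>F\<^esub> Z x" if "x \<in> ?X" for x
      using that fx[OF that] fun_submodules_mem[OF S Z that]
      by (simp add: f'_def a_minus_def F.a_assoc F.l_neg)
  qed
qed

definition precompose ::
    "nat \<Rightarrow> (nat \<Rightarrow> ('a, 'x) ring_scheme) \<Rightarrow> nat \<Rightarrow> (nat \<Rightarrow> (nat \<Rightarrow> 'a) \<Rightarrow> nat \<Rightarrow> 'a)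
      \<Rightarrow> ((nat \<Rightarrow> nat \<Rightarrow> 'a) \<Rightarrow> 'f) \<Rightarrow> (nat \<Rightarrow> nat \<Rightarrow> 'a) \<Rightarrow> 'f" where
  "precompose m K k L f = (\<lambda>x\<in>arg_space m K k. f (\<lambda>j\<in>{1..m}. L j (x j)))"

text \<open>
Treating the arguments one after another: a set \<open>J\<close> collects those in which a rank-one map has been
substituted, and the identity map stands in the others.
\<close>

lemma rank_one_reduction:
  fixes K :: "nat \<Rightarrow> ('a, 'x) ring_scheme" and F :: "('f, 'y) ring_scheme"
  assumes F: "ring F" "finite (carrier F)"
    and K: "\<And>j. j \<in> {1..m} \<Longrightarrow> field (K j)" "\<And>j. j \<in> {1..m} \<Longrightarrow> finite (carrier (K j))"
    and cop: "\<And>j. j \<in> {1..m} \<Longrightarrow> coprime (order (K j)) (order F)"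
    and S: "S \<in> fun_submodules F (arg_space m K k)" and f: "f \<in> kary_functions F m K k"
    and "finite J" "J \<subseteq> {1..m}"
    and H: "\<And>L. (\<And>j. j \<in> J \<Longrightarrow> \<exists>a\<in>vecs (K j) k. \<exists>b\<in>vecs (K j) k. L j = rank_one (K j) k b a) \<Longrightarrow>
      (\<And>j. j \<in> {1..m} - J \<Longrightarrow> L j = (\<lambda>y. y)) \<Longrightarrow> precompose m K k L f \<in> S"
  shows "f \<in> S"
  using \<open>finite J\<close> \<open>J \<subseteq> {1..m}\<close> H
proof (induction J rule: finite_induct)
  case empty
  have "f (restrict x {1..m}) = f x" if "x \<in> arg_space m K k" for x
    using that by (simp add: arg_space_ext)
  then have "precompose m K k (\<lambda>_ y. y) f = f"
    using f by (auto simp: precompose_def kary_functions_def PiE_def extensional_def fun_eq_iff)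
  moreover have "precompose m K k (\<lambda>_ y. y) f \<in> S" by (rule empty.prems(2)) auto
  ultimately show ?case by simp
next
  case (insert j J)
  have j: "j \<in> {1..m}" and J: "J \<subseteq> {1..m}" using insert.prems by auto
  show ?case
  proof (rule insert.IH[OF J])
    fix L assume L1: "\<And>i. i \<in> J \<Longrightarrow> \<exists>a\<in>vecs (K i) k. \<exists>b\<in>vecs (K i) k. L i = rank_one (K i) k b a"
      and L2: "\<And>i. i \<in> {1..m} - J \<Longrightarrow> L i = (\<lambda>y. y)"
    have Lj: "L j = (\<lambda>y. y)" using L2 j insert.hyps by auto
    have Lv: "L i v \<in> vecs (K i) k" if "i \<in> {1..m}" "v \<in> vecs (K i) k" for i v
      using L1[of i] L2[of i] that rank_one_closed[OF K(1)[OF that(1)]] by (cases "i \<in> J") auto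
    show "precompose m K k L f \<in> S"
    proof (rule rank_one_coordinate_reduction[OF F K(1)[OF j] K(2)[OF j] cop[OF j] j S])
      have "f (\<lambda>i\<in>{1..m}. L i (x i)) \<in> carrier F" if "x \<in> arg_space m K k" for x
      proof -
        have "(\<lambda>i\<in>{1..m}. L i (x i)) \<in> arg_space m K k"
          by (intro arg_space_restrictI Lv arg_space_coord[OF that])
        then show ?thesis using f unfolding kary_functions_def by (rule PiE_mem[rotated])
      qed
      then show "precompose m K k L f \<in> kary_functions F m K k"
        by (simp add: precompose_def kary_functions_def)
    next
      fix a b assume ab: "a \<in> vecs (K j) k" "b \<in> vecs (K j) k"
      let ?L = "L(j := rank_one (K j) k b a)"
      have "precompose m K k ?L f \<in> S"
      proof (rule insert.prems(2))
        show "\<exists>a\<in>vecs (K i) k. \<exists>b\<in>vecs (K i) k. ?L i = rank_one (K i) k b a" if "i \<in> insert j J" for i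
          using that L1[of i] ab by (cases "i = j") auto
        show "?L i = (\<lambda>y. y)" if "i \<in> {1..m} - insert j J" for i using that L2[of i] by auto
      qed
      also have "precompose m K k ?L f
          = (\<lambda>x\<in>arg_space m K k. precompose m K k L f (x(j := rank_one (K j) k b a (x j))))"
        unfolding precompose_def[of m K k ?L]
      proof (rule restrict_ext)
        fix x assume x: "x \<in> arg_space m K k"
        let ?x = "x(j := rank_one (K j) k b a (x j))"
        have "?x \<in> arg_space m K k"
          using arg_space_upd[OF x j rank_one_closed[OF K(1)[OF j] ab arg_space_coord[OF x j]]] .
        moreover have "(\<lambda>i\<in>{1..m}. ?L i (x i)) = (\<lambda>i\<in>{1..m}. L i (?x i))"
          using Lj by (intro restrict_ext) auto
        ultimately show "f (\<lambda>i\<in>{1..m}. ?L i (x i)) = precompose m K k L f ?x"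
          by (simp only: precompose_def restrict_apply')
      qed
      finally show "(\<lambda>x\<in>arg_space m K k. precompose m K k L f (x(j := rank_one (K j) k b a (x j)))) \<in> S" .
    qed
  qed
qed

text \<open>
The part is non-empty because substituting zero matrices into any function of the clonoid gives
functions of every arity.
\<close>

lemma arity_part_submodule:
  assumes C: "linearly_closed_clonoid F m K C" and K: "\<And>j. j \<in> {1..m} \<Longrightarrow> ring (K j)" and k: "1 \<le> k"
  shows "arity_part C k \<in> fun_submodules F (arg_space m K k)"
proof -
  obtain n f where nf: "1 \<le> n" "f \<in> arity_part C n"
    using C by (fastforce simp: linearly_closed_clonoid_def arity_part_def)
  define A where "A = (\<lambda>j\<in>{1..m}. \<lambda>r\<in>{1..n}. \<lambda>t\<in>{1..k}. \<zero>\<^bsub>K j\<^esub>)"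
  have "A \<in> (\<Pi>\<^sub>E j\<in>{1..m}. matrices (K j) n k)"
    using K by (auto simp: A_def matrices_def intro!: ring.ring_simprules)
  then have "(\<lambda>x\<in>arg_space m K k. f (\<lambda>j\<in>{1..m}. mat_vec (K j) n k (A j) (x j))) \<in> arity_part C k"
    using C nf k unfolding linearly_closed_clonoid_def by blast
  then have "arity_part C k \<noteq> {}" by blast
  moreover have "arity_part C k \<subseteq> arg_space m K k \<rightarrow>\<^sub>E carrier F"
    using C by (auto simp: linearly_closed_clonoid_def arity_part_def kary_functions_def)
  ultimately show ?thesis
    using C k unfolding linearly_closed_clonoid_def fun_submodules_def by blast
qed

lemma mat_vec_row:
  "mat_vec R 1 k (\<lambda>r\<in>{1..1}. a) y = (\<lambda>r\<in>{1..1}. dot R k a y)"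
  by (auto simp: mat_vec_def dot_def fun_eq_iff)

lemma mat_vec_column:
  assumes "field R" "b \<in> vecs R k" "c \<in> carrier R"
  shows "mat_vec R k 1 (\<lambda>r\<in>{1..k}. \<lambda>t\<in>{1..1}. b r) (\<lambda>r\<in>{1..1}. c) = (\<lambda>r\<in>{1..k}. b r \<otimes>\<^bsub>R\<^esub> c)"
proof -
  interpret field R by fact
  show ?thesis unfolding mat_vec_def
  proof (rule restrict_ext)
    fix r assume r: "r \<in> {1..k}"
    have "b r \<in> carrier R" by (rule vecs_mem[OF assms(2) r])
    then show "(\<Oplus>\<^bsub>R\<^esub>t\<in>{1..1::nat}. (\<lambda>r\<in>{1..k}. \<lambda>t\<in>{1..1}. b r) r t \<otimes>\<^bsub>R\<^esub> (\<lambda>r\<in>{1..1}. c) t) = b r \<otimes>\<^bsub>R\<^esub> c"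
      using r assms(3) by simp
  qed
qed

text \<open>
Substituting \<open>b\<^sub>j a\<^sub>j\<^sup>T\<close> into \<open>f\<close> factors through arity one: the columns \<open>b\<^sub>j\<close> turn \<open>f\<close> into a unary
function, from which the rows \<open>a\<^sub>j\<close> produce a \<open>k\<close>-ary one again. So a clonoid containing these unary
functions contains everything from which \<open>f\<close> can be linearly combined.
\<close>

lemma unary_minors_determine:
  fixes K :: "nat \<Rightarrow> ('a, 'x) ring_scheme" and F :: "('f, 'y) ring_scheme"
  assumes F: "ring F" "finite (carrier F)"
    and K: "\<And>j. j \<in> {1..m} \<Longrightarrow> field (K j)" "\<And>j. j \<in> {1..m} \<Longrightarrow> finite (carrier (K j))"
    and cop: "\<And>j. j \<in> {1..m} \<Longrightarrow> coprime (order (K j)) (order F)"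
    and C: "linearly_closed_clonoid F m K C" and k: "1 \<le> k" and f: "f \<in> kary_functions F m K k"
    and unary: "\<And>B. B \<in> (\<Pi>\<^sub>E j\<in>{1..m}. matrices (K j) k 1) \<Longrightarrow>
      (\<lambda>x\<in>arg_space m K 1. f (\<lambda>j\<in>{1..m}. mat_vec (K j) k 1 (B j) (x j))) \<in> arity_part C 1"
  shows "f \<in> arity_part C k"
proof (rule rank_one_reduction[OF F K cop _ f, where J = "{1..m}"])
  show "arity_part C k \<in> fun_submodules F (arg_space m K k)"
    using K(1) by (intro arity_part_submodule[OF C _ k]) (auto simp: field_def domain_def cring_def)
  fix L :: "nat \<Rightarrow> (nat \<Rightarrow> 'a) \<Rightarrow> nat \<Rightarrow> 'a"
  assume "\<And>j. j \<in> {1..m} \<Longrightarrow> \<exists>a\<in>vecs (K j) k. \<exists>b\<in>vecs (K j) k. L j = rank_one (K j) k b a"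
  then obtain a b where ab: "\<And>j. j \<in> {1..m} \<Longrightarrow> a j \<in> vecs (K j) k"
      "\<And>j. j \<in> {1..m} \<Longrightarrow> b j \<in> vecs (K j) k"
      "\<And>j. j \<in> {1..m} \<Longrightarrow> L j = rank_one (K j) k (b j) (a j)"
    by metis
  define A where "A = (\<lambda>j\<in>{1..m}. \<lambda>r\<in>{1..1::nat}. a j)"
  define B where "B = (\<lambda>j\<in>{1..m}. \<lambda>r\<in>{1..k}. \<lambda>t\<in>{1..1::nat}. b j r)"
  define u where "u = (\<lambda>x\<in>arg_space m K 1. f (\<lambda>j\<in>{1..m}. mat_vec (K j) k 1 (B j) (x j)))"
  have A: "A \<in> (\<Pi>\<^sub>E j\<in>{1..m}. matrices (K j) 1 k)"
    using ab(1) by (auto simp: A_def matrices_def vecs_def)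
  have "B \<in> (\<Pi>\<^sub>E j\<in>{1..m}. matrices (K j) k 1)"
    using vecs_mem[OF ab(2)] by (auto simp: B_def matrices_def)
  then have "u \<in> arity_part C 1" unfolding u_def by (rule unary)
  then have "(\<lambda>x\<in>arg_space m K k. u (\<lambda>j\<in>{1..m}. mat_vec (K j) 1 k (A j) (x j))) \<in> arity_part C k"
    using C k A unfolding linearly_closed_clonoid_def by blast
  also have "(\<lambda>x\<in>arg_space m K k. u (\<lambda>j\<in>{1..m}. mat_vec (K j) 1 k (A j) (x j))) = precompose m K k L f"
    unfolding precompose_def
  proof (rule restrict_ext)
    fix x assume x: "x \<in> arg_space m K k"
    define y where "y = (\<lambda>j\<in>{1..m}. mat_vec (K j) 1 k (A j) (x j))"
    have xj: "x j \<in> vecs (K j) k" if "j \<in> {1..m}" for j by (rule arg_space_coord[OF x that])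
    have yj: "y j = (\<lambda>r\<in>{1..1}. dot (K j) k (a j) (x j))" if j: "j \<in> {1..m}" for j
      using j mat_vec_row[of "K j" k "a j" "x j"] by (simp add: y_def A_def)
    have d: "dot (K j) k (a j) (x j) \<in> carrier (K j)" if j: "j \<in> {1..m}" for j
      by (rule dot_closed[OF K(1)[OF j] ab(1)[OF j] xj[OF j]])
    have "restrict y {1..m} \<in> arg_space m K 1"
    proof (rule arg_space_restrictI)
      fix j assume j: "j \<in> {1..m}"
      show "y j \<in> vecs (K j) 1" unfolding yj[OF j] using d[OF j] by (intro vecs_restrictI)
    qed
    then have "y \<in> arg_space m K 1" by (simp add: y_def)
    then have "u y = f (\<lambda>j\<in>{1..m}. mat_vec (K j) k 1 (B j) (y j))" by (simp add: u_def)
    also have "(\<lambda>j\<in>{1..m}. mat_vec (K j) k 1 (B j) (y j)) = (\<lambda>j\<in>{1..m}. L j (x j))"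
    proof (rule restrict_ext)
      fix j assume j: "j \<in> {1..m}"
      show "mat_vec (K j) k 1 (B j) (y j) = L j (x j)"
        unfolding yj[OF j] ab(3)[OF j]
        using mat_vec_column[OF K(1)[OF j] ab(2)[OF j] d[OF j]] xj[OF j] j
        by (simp add: B_def rank_one_def)
    qed
    finally show "u (\<lambda>j\<in>{1..m}. mat_vec (K j) 1 k (A j) (x j)) = f (\<lambda>j\<in>{1..m}. L j (x j))"
      by (simp only: y_def)
  qed
  finally show "precompose m K k L f \<in> arity_part C k" .
qed auto

lemma unary_part_determines:
  fixes K :: "nat \<Rightarrow> ('a, 'x) ring_scheme" and F :: "('f, 'y) ring_scheme"
  assumes F: "ring F" "finite (carrier F)"
    and K: "\<And>j. j \<in> {1..m} \<Longrightarrow> field (K j)" "\<And>j. j \<in> {1..m} \<Longrightarrow> finite (carrier (K j))"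
    and cop: "\<And>j. j \<in> {1..m} \<Longrightarrow> coprime (order (K j)) (order F)"
    and C: "linearly_closed_clonoid F m K C" and D: "linearly_closed_clonoid F m K D"
    and sub: "arity_part C 1 \<subseteq> arity_part D 1"
  shows "C \<subseteq> D"
proof
  fix kf assume "kf \<in> C"
  then obtain k f where kf: "kf = (k, f)" "1 \<le> k" "f \<in> kary_functions F m K k" "f \<in> arity_part C k"
    using C by (cases kf) (auto simp: linearly_closed_clonoid_def arity_part_def)
  have "f \<in> arity_part D k"
  proof (rule unary_minors_determine[OF F K cop D kf(2,3)])
    fix B assume "B \<in> (\<Pi>\<^sub>E j\<in>{1..m}. matrices (K j) k 1)"
    then have "(\<lambda>x\<in>arg_space m K 1. f (\<lambda>j\<in>{1..m}. mat_vec (K j) k 1 (B j) (x j))) \<in> arity_part C 1"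
      using C kf(2,4) unfolding linearly_closed_clonoid_def by blast
    then show "(\<lambda>x\<in>arg_space m K 1. f (\<lambda>j\<in>{1..m}. mat_vec (K j) k 1 (B j) (x j))) \<in> arity_part D 1"
      using sub by blast
  qed
  then show "kf \<in> D" by (simp add: kf(1) arity_part_def)
qed

section \<open>Splitting the codomain into its factors\<close>

definition coordinate_image :: "'x set \<Rightarrow> 'i \<Rightarrow> ('x \<Rightarrow> 'i \<Rightarrow> 'b) set \<Rightarrow> ('x \<Rightarrow> 'b) set" where
  "coordinate_image X i S = {\<lambda>x\<in>X. f x i | f. f \<in> S}"

lemma product_ring_coord: "a \<in> carrier (product_ring I F) \<Longrightarrow> i \<in> I \<Longrightarrow> a i \<in> carrier (F i)"
  by (auto simp: product_ring_def)

lemma product_ring_restrictI: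
  "(\<And>i. i \<in> I \<Longrightarrow> h i \<in> carrier (F i)) \<Longrightarrow> restrict h I \<in> carrier (product_ring I F)"
  by (simp add: product_ring_def)

lemma product_ring_comb:
  "i \<in> I \<Longrightarrow> ((a \<otimes>\<^bsub>product_ring I F\<^esub> b) \<oplus>\<^bsub>product_ring I F\<^esub> (c \<otimes>\<^bsub>product_ring I F\<^esub> d)) i
    = (a i \<otimes>\<^bsub>F i\<^esub> b i) \<oplus>\<^bsub>F i\<^esub> (c i \<otimes>\<^bsub>F i\<^esub> d i)"
  by (simp add: product_ring_def)

text \<open>
Scalars of the factor \<open>F i\<close> act through their lifts to the product that are \<open>0\<close> in the other places.
\<close>

lemma coordinate_image_submodule:
  assumes F: "\<And>i. i \<in> I \<Longrightarrow> ring (F i)" and S: "S \<in> fun_submodules (product_ring I F) X" and i: "i \<in> I"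
  shows "coordinate_image X i S \<in> fun_submodules (F i) X"
proof -
  let ?P = "product_ring I F"
  interpret P: ring ?P by (rule ring_product_ring) (rule F)
  have "coordinate_image X i S \<noteq> {}" using S by (auto simp: coordinate_image_def fun_submodules_def)
  moreover have "coordinate_image X i S \<subseteq> X \<rightarrow>\<^sub>E carrier (F i)"
    using product_ring_coord[OF fun_submodules_mem[OF S] i] by (auto simp: coordinate_image_def)
  moreover have "(\<lambda>x\<in>X. (a \<otimes>\<^bsub>F i\<^esub> f x) \<oplus>\<^bsub>F i\<^esub> (b \<otimes>\<^bsub>F i\<^esub> g x)) \<in> coordinate_image X i S"
    if ab: "a \<in> carrier (F i)" "b \<in> carrier (F i)"
      and fg: "f \<in> coordinate_image X i S" "g \<in> coordinate_image X i S" for a b f g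
  proof -
    obtain f' g' where f': "f' \<in> S" "f = (\<lambda>x\<in>X. f' x i)" and g': "g' \<in> S" "g = (\<lambda>x\<in>X. g' x i)"
      using fg by (auto simp: coordinate_image_def)
    define lift where "lift c = (\<lambda>l\<in>I. if l = i then c else \<zero>\<^bsub>F l\<^esub>)" for c
    have lift: "lift c \<in> carrier ?P" "lift c i = c" if "c \<in> carrier (F i)" for c
      using that F i by (auto simp: lift_def intro!: product_ring_restrictI ring.ring_simprules)
    define h where "h = (\<lambda>x\<in>X. (lift a \<otimes>\<^bsub>?P\<^esub> f' x) \<oplus>\<^bsub>?P\<^esub> (lift b \<otimes>\<^bsub>?P\<^esub> g' x))"
    have "h \<in> S"
      by (rule fun_submodules_comb[OF S lift(1)[OF ab(1)] lift(1)[OF ab(2)] f'(1) g'(1)]) (simp_all add: h_def)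
    moreover have "(\<lambda>x\<in>X. (a \<otimes>\<^bsub>F i\<^esub> f x) \<oplus>\<^bsub>F i\<^esub> (b \<otimes>\<^bsub>F i\<^esub> g x)) = (\<lambda>x\<in>X. h x i)"
      using f' g' lift(2)[OF ab(1)] lift(2)[OF ab(2)]
      by (intro restrict_ext) (simp add: h_def product_ring_comb[OF i])
    ultimately show ?thesis by (auto simp: coordinate_image_def)
  qed
  ultimately show ?thesis by (simp add: fun_submodules_def)
qed

text \<open>
The idempotents of the product ring glue functions that agree with \<open>f\<close> in single coordinates.
\<close>

lemma coordinate_images_determine:
  assumes F: "\<And>i. i \<in> I \<Longrightarrow> ring (F i)" and "finite I"
    and S: "S \<in> fun_submodules (product_ring I F) X"
    and f: "f \<in> X \<rightarrow>\<^sub>E carrier (product_ring I F)"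
    and images: "\<And>i. i \<in> I \<Longrightarrow> (\<lambda>x\<in>X. f x i) \<in> coordinate_image X i S"
  shows "f \<in> S"
proof -
  let ?P = "product_ring I F"
  interpret P: ring ?P by (rule ring_product_ring) (rule F)
  have agree: "\<exists>h\<in>S. \<forall>i\<in>J. \<forall>x\<in>X. h x i = f x i" if "finite J" "J \<subseteq> I" for J
    using that
  proof (induction J rule: finite_induct)
    case empty
    then show ?case using S by (auto simp: fun_submodules_def)
  next
    case (insert i J)
    then have i: "i \<in> I" and J: "J \<subseteq> I" by auto
    obtain h where h: "h \<in> S" "\<And>l x. l \<in> J \<Longrightarrow> x \<in> X \<Longrightarrow> h x l = f x l"
      using insert.IH[OF J] by blast
    obtain g where g: "g \<in> S" "(\<lambda>x\<in>X. f x i) = (\<lambda>x\<in>X. g x i)"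
      using images[OF i] by (auto simp: coordinate_image_def)
    have gi: "g x i = f x i" if "x \<in> X" for x using fun_cong[OF g(2), of x] that by simp
    \<comment> \<open>\<open>e\<close> selects the coordinate \<open>i\<close>, and \<open>e'\<close> the others.\<close>
    define e where "e = (\<lambda>l\<in>I. if l = i then \<one>\<^bsub>F l\<^esub> else \<zero>\<^bsub>F l\<^esub>)"
    define e' where "e' = (\<lambda>l\<in>I. if l = i then \<zero>\<^bsub>F l\<^esub> else \<one>\<^bsub>F l\<^esub>)"
    have e: "e \<in> carrier ?P" "e' \<in> carrier ?P"
      using F by (auto simp: e_def e'_def intro!: product_ring_restrictI ring.ring_simprules)
    define k where "k = (\<lambda>x\<in>X. (e \<otimes>\<^bsub>?P\<^esub> g x) \<oplus>\<^bsub>?P\<^esub> (e' \<otimes>\<^bsub>?P\<^esub> h x))"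
    have "k \<in> S" by (rule fun_submodules_comb[OF S e g(1) h(1)]) (simp_all add: k_def)
    moreover have "k x l = f x l" if l: "l \<in> insert i J" and x: "x \<in> X" for l x
    proof -
      have lI: "l \<in> I" using l i J by auto
      interpret Fl: ring "F l" by (rule F[OF lI])
      have "g x l \<in> carrier (F l)" "h x l \<in> carrier (F l)"
        using product_ring_coord[OF fun_submodules_mem[OF S _ x] lI] g(1) h(1) by blast+
      moreover have "k x l = (e l \<otimes>\<^bsub>F l\<^esub> g x l) \<oplus>\<^bsub>F l\<^esub> (e' l \<otimes>\<^bsub>F l\<^esub> h x l)"
        using x by (simp add: k_def product_ring_comb[OF lI])
      moreover have "e l = \<one>\<^bsub>F l\<^esub> \<and> e' l = \<zero>\<^bsub>F l\<^esub> \<and> g x l = f x l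
          \<or> e l = \<zero>\<^bsub>F l\<^esub> \<and> e' l = \<one>\<^bsub>F l\<^esub> \<and> h x l = f x l"
        using x l lI gi[OF x] h(2)[OF _ x, of l] by (auto simp: e_def e'_def)
      ultimately show ?thesis by auto
    qed
    ultimately show ?case by blast
  qed
  obtain h where h: "h \<in> S" "\<And>i x. i \<in> I \<Longrightarrow> x \<in> X \<Longrightarrow> h x i = f x i"
    using agree[OF \<open>finite I\<close> subset_refl] by blast
  have "h = f"
  proof (rule PiE_ext[OF fun_submodules_PiE[OF S h(1)] f])
    fix x assume x: "x \<in> X"
    have "h x \<in> (\<Pi>\<^sub>E i\<in>I. carrier (F i))" "f x \<in> (\<Pi>\<^sub>E i\<in>I. carrier (F i))"
      using fun_submodules_mem[OF S h(1) x] PiE_mem[OF f x] by (simp_all add: product_ring_def)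
    then show "h x = f x" by (rule PiE_ext) (rule h(2)[OF _ x])
  qed
  with h show ?thesis by simp
qed

text \<open>
The line spanned by the indicator function of \<open>z\<close>. It is singled out because it never arises from
a clonoid.
\<close>

definition supported_at :: "('b, 'y) ring_scheme \<Rightarrow> 'x set \<Rightarrow> 'x \<Rightarrow> ('x \<Rightarrow> 'b) set" where
  "supported_at R X z = {g \<in> X \<rightarrow>\<^sub>E carrier R. \<forall>x\<in>X. x \<noteq> z \<longrightarrow> g x = \<zero>\<^bsub>R\<^esub>}"

lemma supported_at_submodule:
  assumes "ring R"
  shows "supported_at R X z \<in> fun_submodules R X"
proof -
  interpret ring R by fact
  have "(\<lambda>x\<in>X. \<zero>\<^bsub>R\<^esub>) \<in> supported_at R X z" by (simp add: supported_at_def)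
  then have "supported_at R X z \<noteq> {}" by blast
  moreover have "(\<lambda>x\<in>X. (a \<otimes>\<^bsub>R\<^esub> f x) \<oplus>\<^bsub>R\<^esub> (b \<otimes>\<^bsub>R\<^esub> g x)) \<in> supported_at R X z"
    if "a \<in> carrier R" "b \<in> carrier R" and fg: "f \<in> supported_at R X z" "g \<in> supported_at R X z" for a b f g
  proof -
    have "f x \<in> carrier R" "g x \<in> carrier R" if "x \<in> X" for x
      using fg that by (auto simp: supported_at_def)
    with that show ?thesis by (simp add: supported_at_def)
  qed
  ultimately show ?thesis by (auto simp: fun_submodules_def supported_at_def)
qed

text \<open>
Substituting the zero matrix into the indicator function of \<open>0\<close> yields the constant \<open>1\<close>, which does
not vanish at the point \<open>u\<close> all of whose entries are \<open>1\<close>.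
\<close>

lemma coordinate_image_ne_supported_at:
  assumes F: "\<And>i. i \<in> I \<Longrightarrow> field (F i)" and i: "i \<in> I"
    and K: "\<And>j. j \<in> {1..m} \<Longrightarrow> field (K j)" and m: "1 \<le> m"
    and C: "linearly_closed_clonoid (product_ring I F) m K C"
  shows "coordinate_image (arg_space m K 1) i (arity_part C 1)
    \<noteq> supported_at (F i) (arg_space m K 1) (\<lambda>j\<in>{1..m}. zero_vec (K j) 1)" (is "?S \<noteq> supported_at _ ?X ?z")
proof
  assume eq: "?S = supported_at (F i) ?X ?z"
  interpret Fi: field "F i" by (rule F[OF i])
  have z: "?z \<in> ?X" by (intro arg_space_restrictI zero_vec_closed K)
  define u where "u = (\<lambda>j\<in>{1..m}. \<lambda>t\<in>{1..1::nat}. \<one>\<^bsub>K j\<^esub>)"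
  have one: "\<one>\<^bsub>K j\<^esub> \<in> carrier (K j)" "\<zero>\<^bsub>K j\<^esub> \<in> carrier (K j)" "\<one>\<^bsub>K j\<^esub> \<noteq> \<zero>\<^bsub>K j\<^esub>"
    if j: "j \<in> {1..m}" for j
  proof -
    interpret Kj: field "K j" by (rule K[OF j])
    show "\<one>\<^bsub>K j\<^esub> \<in> carrier (K j)" "\<zero>\<^bsub>K j\<^esub> \<in> carrier (K j)" "\<one>\<^bsub>K j\<^esub> \<noteq> \<zero>\<^bsub>K j\<^esub>" by simp_all
  qed
  have u: "u \<in> ?X" unfolding u_def using one by (intro arg_space_restrictI vecs_restrictI)
  have uz: "u \<noteq> ?z"
  proof
    assume "u = ?z"
    then have "u 1 1 = ?z 1 1" by simp
    then show False using one(3)[of 1] m by (simp add: u_def zero_vec_def)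
  qed
  have "(\<lambda>x\<in>?X. if x = ?z then \<one>\<^bsub>F i\<^esub> else \<zero>\<^bsub>F i\<^esub>) \<in> ?S" unfolding eq by (simp add: supported_at_def)
  then obtain f where f: "f \<in> arity_part C 1"
      "(\<lambda>x\<in>?X. if x = ?z then \<one>\<^bsub>F i\<^esub> else \<zero>\<^bsub>F i\<^esub>) = (\<lambda>x\<in>?X. f x i)"
    by (auto simp: coordinate_image_def)
  have fz: "f ?z i = \<one>\<^bsub>F i\<^esub>" using fun_cong[OF f(2), of ?z] z by (simp only: restrict_apply' if_True refl)
  define A where "A = (\<lambda>j\<in>{1..m}. \<lambda>r\<in>{1..1::nat}. \<lambda>t\<in>{1..1::nat}. \<zero>\<^bsub>K j\<^esub>)"
  have "A \<in> (\<Pi>\<^sub>E j\<in>{1..m}. matrices (K j) 1 1)" using one(2) by (auto simp: A_def matrices_def)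
  then have "(\<lambda>x\<in>?X. f (\<lambda>j\<in>{1..m}. mat_vec (K j) 1 1 (A j) (x j))) \<in> arity_part C 1"
    using C f(1) unfolding linearly_closed_clonoid_def by blast
  moreover have "mat_vec (K j) 1 1 (A j) (x j) = zero_vec (K j) 1" if j: "j \<in> {1..m}" and x: "x \<in> ?X" for j x
  proof -
    interpret Kj: field "K j" by (rule K[OF j])
    have "x j 1 \<in> carrier (K j)" using vecs_mem[OF arg_space_coord[OF x j]] by simp
    then show ?thesis unfolding mat_vec_def zero_vec_def using j by (intro restrict_ext) (simp add: A_def)
  qed
  then have "(\<lambda>x\<in>?X. f (\<lambda>j\<in>{1..m}. mat_vec (K j) 1 1 (A j) (x j))) = (\<lambda>x\<in>?X. f ?z)"
    by (intro restrict_ext arg_cong[where f = f]) simp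
  ultimately have "(\<lambda>x\<in>?X. f ?z) \<in> arity_part C 1" by simp
  then have "(\<lambda>x\<in>?X. (\<lambda>x\<in>?X. f ?z) x i) \<in> ?S" unfolding coordinate_image_def by blast
  then have "(\<lambda>x\<in>?X. f ?z) u i = \<zero>\<^bsub>F i\<^esub>" using u uz unfolding eq by (auto simp: supported_at_def)
  then show False using u fz by simp
qed

section \<open>The bound on the number of clonoids\<close>

theorem theorem1p3:
  fixes m s :: nat and q p :: "nat \<Rightarrow> nat"
    and K :: "nat \<Rightarrow> ('a, 'x) ring_scheme" and F :: "nat \<Rightarrow> ('b, 'y) ring_scheme"
  assumes "1 \<le> m" and "1 \<le> s"
    and "\<And>j. j \<in> {1..m} \<Longrightarrow> field (K j) \<and> finite (carrier (K j)) \<and> order (K j) = q j"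
    and "\<And>i. i \<in> {1..s} \<Longrightarrow> field (F i) \<and> finite (carrier (F i)) \<and> order (F i) = p i"
    and "coprime (order (product_ring {1..m} K)) (order (product_ring {1..s} F))"
  shows "finite (carrier (clonoid_lattice (product_ring {1..s} F) m K)) \<and>
    real (card (carrier (clonoid_lattice (product_ring {1..s} F) m K)))
      \<le> (\<Prod>i=1..s. \<Sum>r=1..(\<Prod>j=1..m. q j). gauss_binomial (p i) (\<Prod>j=1..m. q j) r)"
proof -
  let ?P = "product_ring {1..s} F" and ?n = "\<Prod>j=1..m. q j"
  define X where "X = arg_space m K 1"
  define z where "z = (\<lambda>j\<in>{1..m}. zero_vec (K j) 1)"
  \<comment> \<open>The candidates for the \<open>i\<close>-th component of a unary part. Excluding one subspace is what removes the summand \<open>r = 0\<close> from the bound.\<close>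
  define W where "W i = fun_submodules (F i) X - {supported_at (F i) X z}" for i
  \<comment> \<open>By injectivity of \<open>\<Phi>\<close>, a clonoid is determined by the coordinate images of its unary part.\<close>
  define \<Phi> :: "(nat \<times> ((nat \<Rightarrow> nat \<Rightarrow> 'a) \<Rightarrow> nat \<Rightarrow> 'b)) set \<Rightarrow> nat \<Rightarrow> ((nat \<Rightarrow> nat \<Rightarrow> 'a) \<Rightarrow> 'b) set"
    where "\<Phi> C = (\<lambda>i\<in>{1..s}. coordinate_image X i (arity_part C 1))" for C
  have K: "field (K j)" "finite (carrier (K j))" "order (K j) = q j" if "j \<in> {1..m}" for j
    using assms(3)[OF that] by auto
  have F: "field (F i)" "finite (carrier (F i))" "order (F i) = p i" if "i \<in> {1..s}" for i
    using assms(4)[OF that] by auto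
  have ringF: "ring (F i)" if "i \<in> {1..s}" for i
    using F(1)[OF that] by (simp add: field_def domain_def cring_def)
  have ringK: "ring (K j)" if "j \<in> {1..m}" for j
    using K(1)[OF that] by (simp add: field_def domain_def cring_def)
  have P: "ring ?P" by (rule ring_product_ring) (rule ringF)
  have finP: "finite (carrier ?P)" using F(2) by (auto simp: product_ring_def intro!: finite_PiE)
  have cop: "coprime (order (K j)) (order ?P)" if j: "j \<in> {1..m}" for j
  proof -
    have "order (K j) dvd (\<Prod>j=1..m. order (K j))" using j by (intro dvd_prodI) auto
    also have "\<dots> = order (product_ring {1..m} K)" by (simp add: order_def product_ring_def card_PiE)
    finally show ?thesis using assms(5) by (rule coprime_divisors[OF _ dvd_refl])
  qed
  have finX: "finite X" unfolding X_def arg_space_def using K(2) by (intro finite_PiE) auto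
  have cardX: "card X = ?n"
    unfolding X_def arg_space_def using K(3) by (simp add: card_PiE order_def)
  have sub: "arity_part C 1 \<in> fun_submodules ?P X" if "linearly_closed_clonoid ?P m K C" for C
    unfolding X_def by (rule arity_part_submodule[OF that ringK]) simp_all
  have inj: "inj_on \<Phi> {C. linearly_closed_clonoid ?P m K C}"
  proof -
    have le: "C \<subseteq> D" if C: "linearly_closed_clonoid ?P m K C" and D: "linearly_closed_clonoid ?P m K D"
      and eq: "\<Phi> C = \<Phi> D" for C D
    proof (rule unary_part_determines[OF P finP K(1,2) cop C D])
      show "arity_part C 1 \<subseteq> arity_part D 1"
      proof
        fix f assume f: "f \<in> arity_part C 1"
        show "f \<in> arity_part D 1"
        proof (rule coordinate_images_determine[OF ringF finite_atLeastAtMost sub[OF D] fun_submodules_PiE[OF sub[OF C] f]])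
          fix i assume i: "i \<in> {1..s}"
          have "(\<lambda>x\<in>X. f x i) \<in> \<Phi> C i" using f i by (auto simp: \<Phi>_def coordinate_image_def)
          then show "(\<lambda>x\<in>X. f x i) \<in> coordinate_image X i (arity_part D 1)"
            unfolding eq using i by (simp add: \<Phi>_def)
        qed
      qed
    qed
    show ?thesis
    proof (rule inj_onI)
      fix C D assume "C \<in> {C. linearly_closed_clonoid ?P m K C}" "D \<in> {C. linearly_closed_clonoid ?P m K C}"
        "\<Phi> C = \<Phi> D"
      then show "C = D" using le[of C D] le[of D C] by simp
    qed
  qed
  have im: "\<Phi> ` {C. linearly_closed_clonoid ?P m K C} \<subseteq> (\<Pi>\<^sub>E i\<in>{1..s}. W i)"
  proof (rule image_subsetI)
    fix C assume "C \<in> {C. linearly_closed_clonoid ?P m K C}"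
    then have C: "linearly_closed_clonoid ?P m K C" by simp
    have "coordinate_image X i (arity_part C 1) \<in> W i" if i: "i \<in> {1..s}" for i
      using coordinate_image_submodule[OF ringF sub[OF C] i]
        coordinate_image_ne_supported_at[OF F(1) i K(1) assms(1) C]
      by (simp add: W_def X_def z_def)
    then show "\<Phi> C \<in> (\<Pi>\<^sub>E i\<in>{1..s}. W i)" by (simp add: \<Phi>_def)
  qed
  have finW: "finite (W i)" if "i \<in> {1..s}" for i
    unfolding W_def using finite_fun_submodules[OF F(2)[OF that] finX] by simp
  have fin: "finite (\<Pi>\<^sub>E i\<in>{1..s}. W i)" using finW by (intro finite_PiE) auto
  have cardW: "real (card (W i)) \<le> (\<Sum>r=1..?n. gauss_binomial (p i) ?n r)" if i: "i \<in> {1..s}" for i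
  proof -
    have mem: "supported_at (F i) X z \<in> fun_submodules (F i) X" by (rule supported_at_submodule[OF ringF[OF i]])
    then have "card (fun_submodules (F i) X) = Suc (card (W i))"
      unfolding W_def using card.remove[OF finite_fun_submodules[OF F(2)[OF i] finX] mem] by simp
    then have "real (card (W i)) + 1 \<le> (\<Sum>r=0..?n. gauss_binomial (p i) ?n r)"
      using card_fun_submodules[OF F(1,2)[OF i] finX] by (simp add: cardX F(3)[OF i])
    also have "\<dots> = 1 + (\<Sum>r=1..?n. gauss_binomial (p i) ?n r)"
      by (simp add: sum.atLeast_Suc_atMost gauss_binomial_0 One_nat_def)
    finally show ?thesis by simp
  qed
  have car: "carrier (clonoid_lattice ?P m K) = {C. linearly_closed_clonoid ?P m K C}"
    by (simp add: clonoid_lattice_def)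
  have "real (card {C. linearly_closed_clonoid ?P m K C}) \<le> real (card (\<Pi>\<^sub>E i\<in>{1..s}. W i))"
    using card_inj_on_le[OF inj im fin] by simp
  also have "\<dots> = (\<Prod>i=1..s. real (card (W i)))" by (simp add: card_PiE)
  also have "\<dots> \<le> (\<Prod>i=1..s. \<Sum>r=1..?n. gauss_binomial (p i) ?n r)"
    using cardW by (intro prod_mono) auto
  finally show ?thesis
    unfolding car using inj_on_finite[OF inj im fin] by simp
qed

end
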